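(* Let $n>1$ be an odd integer and let $M$ be either $(n+1)/2$ or $n-1$. Then, modulo $\Phi_n(q)(1-aq^n)(a-q^n)(b-q^n)$, \begin{align*} &\sum_{k=0}^{M}[4k-1]\frac{(aq^{-1},q^{-1}/a,q^{-1}/b,cq^{-1},dq^{-1},q^{-1};q^2)_k}{(q^{2}/a,aq^2,bq^2,q^2/c,q^{2}/d,q^2;q^2)_k}\bigg(\frac{bq^7}{cd}\bigg)^k\\ &\equiv[n]\Theta_q(a,b,n) \sum_{k=0}^{(n+1)/2}\frac{(aq^{-1},q^{-1}/a,q^{-1}/b,q^3/cd;q^2)_k}{(q^2,q^{-2}/b,q^2/c,q^2/d;q^2)_k}q^{2k}, \end{align*} where \begin{align*} \Theta_q(a,b,n)&=\frac{(b-q^n)(ab-1-a^2+aq^n)}{(a-b)(1-ab)}\frac{(bq)^{(n+1)/2}(q^{-2}/b;q^2)_{(n+1)/2}}{(bq^2;q^2)_{(n+1)/2}}\\ &\quad+\frac{(1-aq^n)(a-q^n)}{(a-b)(1-ab)}\frac{(b;q^2)_2(q^{-1};q^2)_{(n+1)/2}^2}{(q^{-1};q^2)_2(q^2/a,aq^{2};q^2)_{(n+1)/2}}. \end{align*}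
   Context: Here $q,a,b,c,d$ are indeterminates. The $q$-shifted factorial is $(x;q)_0=1$, $(x;q)_k=(1-x)(1-xq)\cdots(1-xq^{k-1})$ for $k\ge1$, and $(x_1,\dots,x_m;q)_k=(x_1;q)_k\cdots(x_m;q)_k$. The $q$-integer is $[m]=(1-q^m)/(1-q)$, and $\Phi_n(q)$ is the $n$-th cyclotomic polynomial in $q$. A congruence $A\equiv B$ modulo a polynomial $P$ between rational functions means that $A-B$ is a rational function whose numerator is divisible by $P$ and whose denominator is coprime to $P$. *)

theory Defs
  imports "HOL-Computational_Algebra.Polynomial" "HOL-Computational_Algebra.Fraction_Field"
begin

text \<open>Polynomials in the five indeterminates q, a, b, c, d with integer coefficients,
  realised as nested univariate polynomials: innermost variable q, then a, b, c, outermost d.\<close>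
type_synonym R = "int poly poly poly poly poly"

definition Xq :: R where "Xq = [:[:[:[:[:0, 1:]:]:]:]:]"
definition Xa :: R where "Xa = [:[:[:[:0, 1:]:]:]:]"
definition Xb :: R where "Xb = [:[:[:0, 1:]:]:]"
definition Xc :: R where "Xc = [:[:0, 1:]:]"
definition Xd :: R where "Xd = [:0, 1:]"

definition vq :: "R fract" where "vq = Fract Xq 1"
definition va :: "R fract" where "va = Fract Xa 1"
definition vb :: "R fract" where "vb = Fract Xb 1"
definition vc :: "R fract" where "vc = Fract Xc 1"
definition vd :: "R fract" where "vd = Fract Xd 1"

text \<open>Cyclotomic polynomials over the integers:
  Phi_n = (X^n - 1) / prod_{d | n, d < n} Phi_d (exact division).\<close>
function cyclotomic :: "nat \<Rightarrow> int poly" where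
  "cyclotomic n = (if n = 0 then 1 else
     (monom 1 n - 1) div (\<Prod>d \<in> {d. d dvd n \<and> d < n}. cyclotomic d))"
  by auto
termination
  by (relation "measure id") auto

definition cyclo_q :: "nat \<Rightarrow> R" where
  "cyclo_q n = [:[:[:[:cyclotomic n:]:]:]:]"

definition cong_rat :: "R fract \<Rightarrow> R fract \<Rightarrow> R \<Rightarrow> bool" where
  "cong_rat A B P \<longleftrightarrow> (\<exists>N D. D \<noteq> 0 \<and> coprime D P \<and> P dvd N \<and> A - B = Fract N D)"

definition qpoch :: "'a::field \<Rightarrow> 'a \<Rightarrow> nat \<Rightarrow> 'a" where
  "qpoch x p k = (\<Prod>j<k. 1 - x * p ^ j)"

definition qint :: "'a::field \<Rightarrow> int \<Rightarrow> 'a" where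
  "qint q m = (1 - q powi m) / (1 - q)"

definition Theta :: "'a::field \<Rightarrow> 'a \<Rightarrow> 'a \<Rightarrow> nat \<Rightarrow> 'a" where
  "Theta q a b n =
     (b - q ^ n) * (a * b - 1 - a ^ 2 + a * q ^ n) / ((a - b) * (1 - a * b))
       * ((b * q) ^ ((n + 1) div 2) * qpoch (inverse (q ^ 2 * b)) (q ^ 2) ((n + 1) div 2)
          / qpoch (b * q ^ 2) (q ^ 2) ((n + 1) div 2))
   + (1 - a * q ^ n) * (a - q ^ n) / ((a - b) * (1 - a * b))
       * (qpoch b (q ^ 2) 2 * (qpoch (inverse q) (q ^ 2) ((n + 1) div 2)) ^ 2
          / (qpoch (inverse q) (q ^ 2) 2 * qpoch (q ^ 2 / a) (q ^ 2) ((n + 1) div 2)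
             * qpoch (a * q ^ 2) (q ^ 2) ((n + 1) div 2)))"

end

theory Submission
  imports Defs "HOL-Computational_Algebra.Polynomial_Factorial"
begin

text \<open>
  The four factors of the modulus are pairwise coprime, so they can be treated separately.
  Modulo \<open>a - q\<^sup>n\<close>, \<open>1 - a q\<^sup>n\<close> and \<open>b - q\<^sup>n\<close> one may substitute \<open>a = q\<^sup>n\<close>, \<open>a = q\<^sup>-\<^sup>n\<close> and \<open>b = q\<^sup>n\<close>:
  the left-hand side then terminates at \<open>k = N = (n + 1) / 2\<close> and Watson's transformation of a terminating
  very-well-poised \<open>8\<phi>7\<close> series into a balanced \<open>4\<phi>3\<close> series turns the congruence into an identity; the factor
  Theta is built so that each substitution leaves only one of its two summands, the prefactor of Watson's formula.
  Modulo \<open>\<Phi>\<^sub>n(q)\<close> both sides vanish: the right-hand side because of \<open>[n]\<close>, the left-hand side because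
  \<open>q\<^sup>n \<equiv> 1\<close> makes the terms with indices \<open>k\<close> and \<open>N - k\<close> opposite, and the terms beyond \<open>N\<close>
  contain \<open>1 - q\<^sup>n\<close>.
\<close>

section \<open>Watson's transformation\<close>

text \<open>A congruence between rational functions makes sense only once every denominator is known
  to be coprime to the modulus, and this governs the layout: for each factor P one works in the ring
  of fractions with denominators coprime to P, where replacing a or b respects quotients. For the
  linear factors coprimality is tested at a real zero of P with q = 2: n is odd, while the
  denominators compare a and b with even powers of q only. For Phi_n the variables a, b, c, d are
  set to 0 or 1, which turns each denominator factor involving them into a unit times a power of q;
  the factors 1 - q^m are handled by divisibility in Z[q], and the bound k < n matters because Phi_n
  divides 1 - q^(2n). The coefficients in Theta are Chinese remainder multipliers: with y = q^n, the
  identity (b - y)(ab - 1 - a^2 + ay) + (1 - ay)(a - y) = (a - b)(1 - ab) says that they add up to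
  1, so whichever survives equals 1.\<close>

lemma qpoch_0 [simp]: "qpoch x p 0 = 1"
  by (simp add: qpoch_def)

lemma qpoch_Suc: "qpoch x p (Suc k) = qpoch x p k * (1 - x * p ^ k)"
  by (simp add: qpoch_def mult.commute)

lemma qpoch_add: "qpoch x p (m + k) = qpoch x p m * qpoch (x * p ^ m) p k"
  by (induction k) (simp_all add: qpoch_Suc power_add mult_ac)

lemma qpoch_Suc': "qpoch x p (Suc k) = (1 - x) * qpoch (x * p) p k"
  using qpoch_add[of x p 1 k] by (simp add: qpoch_Suc)

lemma qpoch_eq_0_iff: "qpoch x p k = 0 \<longleftrightarrow> (\<exists>j<k. x * p ^ j = 1)"
  by (auto simp: qpoch_def)

lemma qpoch_inverse_power_eq_0:
  assumes "p \<noteq> 0" "N < k" shows "qpoch (inverse (p ^ N)) p k = 0"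
  using assms by (auto simp: qpoch_eq_0_iff intro!: exI[of _ N])

text \<open>The two certificates are of Wilf-Zeilberger type: for a sum \<open>\<Sum>\<^sub>k f(N, k) = r(N)\<close> they make
  \<open>f(N + 1, k) - r(N + 1) / r(N) f(N, k)\<close> telescope in \<open>k\<close>. Here \<open>y\<close> stands for \<open>p ^ N\<close>
  (respectively \<open>p ^ (N + 1)\<close>) and \<open>z\<close> for \<open>p ^ (m + 1)\<close>.\<close>

lemma q_saalschutz_certificate:
  fixes A b c y z :: "'a::field"
  assumes "b \<noteq> 0" "c \<noteq> 0" "y \<noteq> 0" "p \<noteq> 0" "1 - z \<noteq> 0"
    "b - A * z \<noteq> 0" "c - A * z \<noteq> 0" "b - A * p * y \<noteq> 0" "c - A * p * y \<noteq> 0"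
  shows "((1 - 1 / (p * y)) * (1 - A * y * z) - 
     (1 - b * y) * (1 - c * y) * (A * p / (b * c)) / ((1 - A * p * y / b) * (1 - A * p * y / c)) * (1 - z / (p * y)) * (1 - A * y)) * z
       / ((1 - z) * (1 - A * z / b) * (1 - A * z / c))
   = (1 - A * p * y * y) / ((1 - A * p * y / b) * (1 - A * p * y / c)) *
     ((1 - z / (p * y)) * (1 - A * y * z) * (1 - A * p / (b * c) * z) / ((1 - z) * (1 - A * z / b) * (1 - A * z / c)) - 1)"
proof -
  \<comment> \<open>In this shape the hypotheses supply every nonzero denominator, and clearing them
    leaves a polynomial identity.\<close>
  have *: "1 - A * z / b = (b - A * z) / b" "1 - A * z / c = (c - A * z) / c"
     "1 - A * p * y / b = (b - A * p * y) / b" "1 - A * p * y / c = (c - A * p * y) / c"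
    using assms by (simp_all add: field_simps)
  show ?thesis unfolding * using assms
    by (simp add: divide_simps) (simp add: algebra_simps)
qed

lemma six_phi_five_certificate:
  fixes A b c y z :: "'a::field"
  assumes "A \<noteq> 0" "b \<noteq> 0" "c \<noteq> 0" "y \<noteq> 0" "1 - z \<noteq> 0" "1 - A * y * z \<noteq> 0"
    "b - A * z \<noteq> 0" "c - A * z \<noteq> 0" "b - A * y \<noteq> 0" "c - A * y \<noteq> 0"
  shows "(1 - A * z ^ 2) * ((1 - 1 / y) * z * (1 - A * y) / (1 - A * y * z)
     - (1 - A * y) * (1 - A * y / (b * c)) / ((1 - A * y / b) * (1 - A * y / c)) * (1 - z / y))
       / ((1 - z) * (1 - A * z / b) * (1 - A * z / c))
   = (1 - A * y) * (A * y / (b * c)) / ((1 - A * y / b) * (1 - A * y / c)) *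
     ((1 - z / y) * (1 - A * z) * (1 - b * z) * (1 - c * z) / ((1 - z) * (1 - A * z / b) * (1 - A * z / c) * (1 - A * y * z)) - b * c / (A * y))"
proof -
  have *: "1 - A * z / b = (b - A * z) / b" "1 - A * z / c = (c - A * z) / c"
     "1 - A * y / b = (b - A * y) / b" "1 - A * y / c = (c - A * y) / c"
    using assms by (simp_all add: field_simps)
  show ?thesis unfolding * using assms
    by (simp add: divide_simps) (simp add: algebra_simps power2_eq_square)
qed

text \<open>The right-hand side is the antidifference, stated for every upper limit m because the
  induction runs on m. At m = N + 1 its factor \<open>qpoch (inverse (p ^ N)) p m\<close> vanishes,
  which leaves the recurrence in N.\<close>

lemma q_saalschutz_partial:
  fixes A b c p :: "'a::field"
  assumes nz: "b \<noteq> 0" "c \<noteq> 0" "p \<noteq> 0"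
    and p1: "\<And>i. 0 < i \<Longrightarrow> p ^ i \<noteq> 1"
    and Ab: "\<And>i. 0 < i \<Longrightarrow> A * p ^ i \<noteq> b" and Ac: "\<And>i. 0 < i \<Longrightarrow> A * p ^ i \<noteq> c"
  defines "X \<equiv> A * p / (b * c)"
  defines "f \<equiv> \<lambda>N j. qpoch (inverse (p ^ N)) p j * qpoch (A * p ^ N) p j * qpoch X p j
              / (qpoch p p j * qpoch (A * p / b) p j * qpoch (A * p / c) p j) * p ^ j"
  shows "(\<Sum>j\<le>m. f (Suc N) j - (1 - b * p ^ N) * (1 - c * p ^ N) * X
             / ((1 - A * p * p ^ N / b) * (1 - A * p * p ^ N / c)) * f N j)
       = (1 - A * p * p ^ N * p ^ N) / ((1 - A * p * p ^ N / b) * (1 - A * p * p ^ N / c)) *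
         (qpoch (inverse (p ^ N)) p m * qpoch (A * p ^ Suc N) p m * qpoch X p (Suc m)
           / (qpoch p p m * qpoch (A * p / b) p m * qpoch (A * p / c) p m))"
proof -
  define y where "y = p ^ N"
  define Q where "Q = (1 - b * y) * (1 - c * y) * X / ((1 - A * p * y / b) * (1 - A * p * y / c))"
  define \<kappa> where "\<kappa> = (1 - A * p * y * y) / ((1 - A * p * y / b) * (1 - A * p * y / c))"
  define s where "s m = qpoch (inverse (p ^ N)) p m * qpoch (A * p ^ Suc N) p m * qpoch X p (Suc m)
           / (qpoch p p m * qpoch (A * p / b) p m * qpoch (A * p / c) p m)" for m
  have y: "y \<noteq> 0" "b - A * p * y \<noteq> 0" "c - A * p * y \<noteq> 0"
    using nz Ab[of "Suc N"] Ac[of "Suc N"] by (simp_all add: y_def mult_ac)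
  have "(\<Sum>j\<le>m. f (Suc N) j - Q * f N j) = \<kappa> * s m"
  proof (induction m)
    case 0
    have "b * c * ((1 - A * p * y / b) * (1 - A * p * y / c)) = (b - A * p * y) * (c - A * p * y)"
      using nz by (simp add: field_simps)
    hence "(1 - A * p * y / b) * (1 - A * p * y / c) \<noteq> 0" using y nz by auto
    thus ?case using nz
      by (simp add: f_def s_def qpoch_Suc \<kappa>_def Q_def X_def divide_simps) (simp add: algebra_simps)
  next
    case (Suc m)
    define z where "z = p * p ^ m"
    define D where "D = (1 - z) * (1 - A * z / b) * (1 - A * z / c)"
    have z: "1 - z \<noteq> 0" "b - A * z \<noteq> 0" "c - A * z \<noteq> 0"
      using p1[of "Suc m"] Ab[of "Suc m"] Ac[of "Suc m"] by (simp_all add: z_def)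
    have den: "qpoch p p (Suc m) * qpoch (A * p / b) p (Suc m) * qpoch (A * p / c) p (Suc m)
       = qpoch p p m * qpoch (A * p / b) p m * qpoch (A * p / c) p m * D"
      by (simp add: qpoch_Suc D_def z_def mult_ac)
    have ip: "p * (inverse p * x) = x" for x using nz by (simp flip: mult.assoc)
    \<comment> \<open>All three quantities are written as \<open>s m\<close> times a rational
      function of y and z. To reach the common part, (p^(-N-1))_(m+1) and (A p^N)_(m+1) lose their
      first factor, the other products their last one.\<close>
    have 1: "f (Suc N) (Suc m) = s m * ((1 - 1 / (p * y)) * (1 - A * y * z) * z / D)"
      unfolding f_def s_def den unfolding qpoch_Suc'[of "inverse (p ^ Suc N)"] qpoch_Suc[of "A * p ^ Suc N"] 
      using nz by (simp add: y_def z_def mult_ac divide_inverse ip)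
    have 2: "f N (Suc m) = s m * ((1 - z / (p * y)) * (1 - A * y) * z / D)"
      unfolding f_def s_def den unfolding qpoch_Suc'[of "A * p ^ N"] qpoch_Suc[of "inverse (p ^ N)"] 
      using nz by (simp add: y_def z_def mult_ac divide_inverse)
    have 3: "s (Suc m) = s m * ((1 - z / (p * y)) * (1 - A * y * z) * (1 - X * z) / D)"
      unfolding s_def den unfolding qpoch_Suc[of "inverse (p ^ N)"] qpoch_Suc[of "A * p ^ Suc N"] qpoch_Suc[of X _ "Suc m"] 
      using nz by (simp add: y_def z_def mult_ac divide_inverse)
    have "f (Suc N) (Suc m) - Q * f N (Suc m) = s m *
      (((1 - 1 / (p * y)) * (1 - A * y * z) - Q * (1 - z / (p * y)) * (1 - A * y)) * z / D)"
    proof -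
      have "s * (u * v * z / D) - Q * (s * (u' * v' * z / D)) = s * ((u * v - Q * u' * v') * z / D)"
        for s u v z D Q u' v' :: 'a by (simp add: algebra_simps diff_divide_distrib)
      thus ?thesis unfolding 1 2 .
    qed
    also have "\<dots> = s m * (\<kappa> * ((1 - z / (p * y)) * (1 - A * y * z) * (1 - X * z) / D - 1))"
      unfolding Q_def D_def \<kappa>_def X_def by (subst q_saalschutz_certificate) (use nz y z in auto)
    also have "\<dots> = \<kappa> * s (Suc m) - \<kappa> * s m"
      unfolding 3 by (simp add: algebra_simps)
    finally show ?case using Suc.IH by simp
  qed
  thus ?thesis by (simp add: Q_def \<kappa>_def y_def s_def)
qed

text \<open>The numerator parameter \<open>A * p / (b * c)\<close> is forced by balancing. This
  arrangement puts (b)_N (c)_N on the right, so that N can later play the role of the summation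
  index k in Watson's formula.\<close>

lemma q_saalschutz:
  fixes A b c p :: "'a::field"
  assumes nz: "b \<noteq> 0" "c \<noteq> 0" "p \<noteq> 0"
    and p1: "\<And>i. 0 < i \<Longrightarrow> p ^ i \<noteq> 1"
    and Ab: "\<And>i. 0 < i \<Longrightarrow> A * p ^ i \<noteq> b" and Ac: "\<And>i. 0 < i \<Longrightarrow> A * p ^ i \<noteq> c"
  shows "(\<Sum>j\<le>N. qpoch (inverse (p ^ N)) p j * qpoch (A * p ^ N) p j * qpoch (A * p / (b * c)) p j
              / (qpoch p p j * qpoch (A * p / b) p j * qpoch (A * p / c) p j) * p ^ j)
       = qpoch b p N * qpoch c p N / (qpoch (A * p / b) p N * qpoch (A * p / c) p N) * (A * p / (b * c)) ^ N"
proof (induction N)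
  case 0
  show ?case by simp
next
  case (Suc N)
  let ?f = "\<lambda>N j. qpoch (inverse (p ^ N)) p j * qpoch (A * p ^ N) p j * qpoch (A * p / (b * c)) p j
              / (qpoch p p j * qpoch (A * p / b) p j * qpoch (A * p / c) p j) * p ^ j"
  let ?Q = "(1 - b * p ^ N) * (1 - c * p ^ N) * (A * p / (b * c))
             / ((1 - A * p * p ^ N / b) * (1 - A * p * p ^ N / c))"
  have "(\<Sum>j\<le>Suc N. ?f (Suc N) j - ?Q * ?f N j) = 0"
    by (subst q_saalschutz_partial[OF assms])
       (simp_all add: qpoch_inverse_power_eq_0 \<open>p \<noteq> 0\<close>)
  hence "(\<Sum>j\<le>Suc N. ?f (Suc N) j) = ?Q * (\<Sum>j\<le>Suc N. ?f N j)"
    by (simp only: sum_subtractf sum_distrib_left right_minus_eq)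
  also have "(\<Sum>j\<le>Suc N. ?f N j) = (\<Sum>j\<le>N. ?f N j)"
    by (simp add: qpoch_inverse_power_eq_0 \<open>p \<noteq> 0\<close>)
  finally show ?case unfolding Suc.IH
    by (simp add: qpoch_Suc mult_ac)
qed

text \<open>Passing from N to N + 1 also changes a bottom parameter and the argument, hence
  \<open>den2\<close> and \<open>pw\<close>. Leaving \<open>1 - A * (p ^ k)\<^sup>2\<close>
  undivided by \<open>1 - A\<close> keeps A = 1 admissible.\<close>

lemma six_phi_five_partial:
  fixes A b c p :: "'a::field"
  assumes nz: "A \<noteq> 0" "b \<noteq> 0" "c \<noteq> 0" "p \<noteq> 0"
    and p1: "\<And>i. 0 < i \<Longrightarrow> p ^ i \<noteq> 1" and A1: "\<And>i. 0 < i \<Longrightarrow> A * p ^ i \<noteq> 1"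
    and Ab: "\<And>i. 0 < i \<Longrightarrow> A * p ^ i \<noteq> b" and Ac: "\<And>i. 0 < i \<Longrightarrow> A * p ^ i \<noteq> c"
  defines "s \<equiv> \<lambda>N k. qpoch A p k * qpoch b p k * qpoch c p k * qpoch (inverse (p ^ N)) p k
              / (qpoch p p k * qpoch (A * p / b) p k * qpoch (A * p / c) p k * qpoch (A * p ^ Suc N) p k)
              * (A * p ^ Suc N / (b * c)) ^ k"
  shows "(\<Sum>k\<le>m. (1 - A * (p ^ k)\<^sup>2) * s (Suc N) k - 
            (1 - A * p ^ Suc N) * (1 - A * p ^ Suc N / (b * c))
             / ((1 - A * p ^ Suc N / b) * (1 - A * p ^ Suc N / c)) * ((1 - A * (p ^ k)\<^sup>2) * s N k))
       = (1 - A * p ^ Suc N) * (A * p ^ Suc N / (b * c)) / ((1 - A * p ^ Suc N / b) * (1 - A * p ^ Suc N / c)) *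
         (s N m * ((1 - A * p ^ m) * (1 - b * p ^ m) * (1 - c * p ^ m) / (1 - A * p ^ Suc N * p ^ m)))"
proof -
  define y where "y = p ^ Suc N"
  define Q where "Q = (1 - A * y) * (1 - A * y / (b * c)) / ((1 - A * y / b) * (1 - A * y / c))"
  define \<kappa> where "\<kappa> = (1 - A * y) * (A * y / (b * c)) / ((1 - A * y / b) * (1 - A * y / c))"
  define e where "e x = (1 - A * x) * (1 - b * x) * (1 - c * x) / (1 - A * y * x)" for x
  have y: "y \<noteq> 0" "b - A * y \<noteq> 0" "c - A * y \<noteq> 0" "1 - A * y \<noteq> 0"
    using nz Ab[of "Suc N"] Ac[of "Suc N"] A1[of "Suc N"] by (simp_all add: y_def mult_ac)
  have "(\<Sum>k\<le>m. (1 - A * (p ^ k)\<^sup>2) * s (Suc N) k - Q * ((1 - A * (p ^ k)\<^sup>2) * s N k)) = \<kappa> * (s N m * e (p ^ m))"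
  proof (induction m)
    case 0
    have "b * c * ((1 - A * y / b) * (1 - A * y / c)) = (b - A * y) * (c - A * y)"
      using nz by (simp add: field_simps)
    hence "(1 - A * y / b) * (1 - A * y / c) \<noteq> 0" using y nz by auto
    thus ?case using nz y
      by (simp add: s_def e_def \<kappa>_def Q_def divide_simps) (simp add: algebra_simps)
  next
    case (Suc m)
    define x where "x = p ^ m"
    define z where "z = p * x"
    define D where "D = (1 - z) * (1 - A * z / b) * (1 - A * z / c)"
    have z: "1 - z \<noteq> 0" "b - A * z \<noteq> 0" "c - A * z \<noteq> 0" "1 - A * y * z \<noteq> 0" "1 - A * y * x \<noteq> 0"
      using p1[of "Suc m"] Ab[of "Suc m"] Ac[of "Suc m"] A1[of "Suc m + Suc N"] A1[of "m + Suc N"] 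
      by (simp_all add: z_def x_def y_def power_add mult_ac)
    have den: "qpoch p p (Suc m) * qpoch (A * p / b) p (Suc m) * qpoch (A * p / c) p (Suc m)
       = qpoch p p m * qpoch (A * p / b) p m * qpoch (A * p / c) p m * D"
      by (simp add: qpoch_Suc D_def z_def x_def mult_ac)
    \<comment> \<open>Both products are compared by extending them to (A p^(N+1))_(m+2).\<close>
    have "(1 - A * y) * qpoch (A * p ^ Suc (Suc N)) p (Suc m) = qpoch (A * p ^ Suc N) p (Suc (Suc m))"
      by (subst qpoch_Suc'[of "A * p ^ Suc N"]) (simp add: y_def mult_ac)
    also have "\<dots> = qpoch (A * p ^ Suc N) p m * (1 - A * y * x) * (1 - A * y * z)"
      by (simp add: qpoch_Suc y_def x_def z_def mult_ac)
    finally have den2: "qpoch (A * p ^ Suc (Suc N)) p (Suc m) = 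
        qpoch (A * p ^ Suc N) p m * ((1 - A * y * x) * (1 - A * y * z) / (1 - A * y))"
      using y by (simp add: field_simps)
    have pw: "(A * p ^ Suc (Suc N) / (b * c)) ^ Suc m = (A * p ^ Suc N / (b * c)) ^ m * (A * y / (b * c) * z)"
      by (simp add: y_def z_def x_def power_mult_distrib power_divide mult_ac)
    have ip: "p * (inverse p * x) = x" for x using nz by (simp flip: mult.assoc)
    have 1: "s (Suc N) (Suc m) = s N m * e x * (A * y / (b * c)) * ((1 - 1 / y) * z * (1 - A * y) / (1 - A * y * z) / D)"
      unfolding s_def den den2 pw unfolding qpoch_Suc'[of "inverse (p ^ Suc N)"] qpoch_Suc[of A] qpoch_Suc[of b] qpoch_Suc[of c]
      using nz by (simp add: y_def x_def e_def mult_ac divide_inverse ip)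
    have 2: "s N (Suc m) = s N m * e x * (A * y / (b * c)) * ((1 - z / y) / D)"
      unfolding s_def den unfolding qpoch_Suc[of "inverse (p ^ N)"] qpoch_Suc[of A] qpoch_Suc[of b] qpoch_Suc[of c] qpoch_Suc[of "A * p ^ Suc N"]
      using nz by (simp add: y_def x_def z_def e_def mult_ac divide_inverse)
    have zz: "p ^ Suc m = z" by (simp add: z_def x_def)
    have "(1 - A * z\<^sup>2) * s (Suc N) (Suc m) - Q * ((1 - A * z\<^sup>2) * s N (Suc m)) 
      = s N m * e x * (A * y / (b * c)) * ((1 - A * z\<^sup>2) * ((1 - 1 / y) * z * (1 - A * y) / (1 - A * y * z)
           - Q * (1 - z / y)) / D)"
    proof -
      have "x * (s * (u / D)) - Q * (x * (s * (v / D))) = s * (x * (u - Q * v) / D)"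
        for s u v x D Q :: 'a by (simp add: algebra_simps diff_divide_distrib)
      thus ?thesis unfolding 1 2 .
    qed
    also have "\<dots> = s N m * e x * (A * y / (b * c)) * (\<kappa> * ((1 - z / y) * (1 - A * z) * (1 - b * z) * (1 - c * z) / (D * (1 - A * y * z)) - b * c / (A * y)))"
      unfolding Q_def D_def \<kappa>_def by (subst six_phi_five_certificate) (use nz y z in auto)
    also have "\<dots> = \<kappa> * (s N (Suc m) * e z) - \<kappa> * (s N m * e x)"
    proof -
      \<comment> \<open>Since Y i = 1, the constant part of the certificate reproduces the previous
        antidifference.\<close>
      have "S * Y * (k * (v * u1 * u2 * u3 / (D * E) - i)) = k * (S * Y * (v / D) * (u1 * u2 * u3 / E)) - k * S"
        if "Y * i = 1" for S Y k v u1 u2 u3 D E i :: 'a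
      proof -
        have "S * Y * (k * (v * u1 * u2 * u3 / (D * E) - i)) = S * Y * k * (v * u1 * u2 * u3 / (D * E)) - k * S * (Y * i)"
          by (simp only: right_diff_distrib mult_ac)
        thus ?thesis using that by simp
      qed
      from this[of "A * y / (b * c)" "b * c / (A * y)"] show ?thesis
        unfolding 2 e_def[of z] using nz y by simp
    qed
    finally show ?case using Suc.IH by (simp add: zz x_def del: power_Suc)
  qed
  thus ?thesis by (simp add: Q_def \<kappa>_def y_def e_def)
qed

lemma six_phi_five:
  fixes A b c p :: "'a::field"
  assumes nz: "A \<noteq> 0" "b \<noteq> 0" "c \<noteq> 0" "p \<noteq> 0"
    and p1: "\<And>i. 0 < i \<Longrightarrow> p ^ i \<noteq> 1" and A1: "\<And>i. 0 < i \<Longrightarrow> A * p ^ i \<noteq> 1"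
    and Ab: "\<And>i. 0 < i \<Longrightarrow> A * p ^ i \<noteq> b" and Ac: "\<And>i. 0 < i \<Longrightarrow> A * p ^ i \<noteq> c"
  shows "(\<Sum>k\<le>N. (1 - A * (p ^ k)\<^sup>2) * 
             (qpoch A p k * qpoch b p k * qpoch c p k * qpoch (inverse (p ^ N)) p k
              / (qpoch p p k * qpoch (A * p / b) p k * qpoch (A * p / c) p k * qpoch (A * p ^ Suc N) p k)
              * (A * p ^ Suc N / (b * c)) ^ k))
       = (1 - A) * (qpoch (A * p) p N * qpoch (A * p / (b * c)) p N / (qpoch (A * p / b) p N * qpoch (A * p / c) p N))"
proof (induction N)
  case 0
  show ?case by simp
next
  case (Suc N)
  let ?f = "\<lambda>N k. (1 - A * (p ^ k)\<^sup>2) * 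
             (qpoch A p k * qpoch b p k * qpoch c p k * qpoch (inverse (p ^ N)) p k
              / (qpoch p p k * qpoch (A * p / b) p k * qpoch (A * p / c) p k * qpoch (A * p ^ Suc N) p k)
              * (A * p ^ Suc N / (b * c)) ^ k)"
  let ?Q = "(1 - A * p ^ Suc N) * (1 - A * p ^ Suc N / (b * c))
             / ((1 - A * p ^ Suc N / b) * (1 - A * p ^ Suc N / c))"
  have "(\<Sum>j\<le>Suc N. ?f (Suc N) j - ?Q * ?f N j) = 0"
    by (subst six_phi_five_partial[OF assms])
       (simp_all add: qpoch_inverse_power_eq_0 \<open>p \<noteq> 0\<close>)
  hence "(\<Sum>j\<le>Suc N. ?f (Suc N) j) = ?Q * (\<Sum>j\<le>Suc N. ?f N j)"
    by (simp only: sum_subtractf sum_distrib_left right_minus_eq)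
  also have "(\<Sum>j\<le>Suc N. ?f N j) = (\<Sum>j\<le>N. ?f N j)"
    by (simp add: qpoch_inverse_power_eq_0 \<open>p \<noteq> 0\<close>)
  finally show ?case unfolding Suc.IH
    by (simp add: qpoch_Suc mult_ac)
qed

section \<open>Reversal of q-shifted factorials, and Watson's formula\<close>

text \<open>Each of the j factors is turned by 1 - p^(-m) = -p^(-m) (1 - p^m) into a factor of
  (p)_(j+i) / (p)_i; the powers of p collect into the product over l and p^(-ij).\<close>

lemma qpoch_inverse_power_prefix:
  fixes p :: "'a::field"
  assumes "p \<noteq> 0"
  shows "qpoch (inverse (p ^ (j + i))) p j * qpoch p p i
       = qpoch p p (j + i) * (\<Prod>l<j. - inverse (p ^ Suc l)) * inverse (p ^ j) ^ i"
proof (induction j)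
  case (Suc j)
  have "qpoch (inverse (p ^ (Suc j + i))) p (Suc j) * qpoch p p i
    = (1 - inverse (p ^ (Suc j + i))) * (qpoch (inverse (p ^ (j + i))) p j * qpoch p p i)"
    unfolding qpoch_Suc' using assms by (simp add: field_simps)
  also have "\<dots> = qpoch p p (j + i) * (1 - p ^ (Suc j + i)) * ((\<Prod>l<j. - inverse (p ^ Suc l)) * - inverse (p ^ Suc j)) * inverse (p ^ Suc j) ^ i"
    unfolding Suc.IH using assms by (simp add: field_simps power_add power_mult_distrib)
  also have "\<dots> = qpoch p p (Suc j + i) * (\<Prod>l<Suc j. - inverse (p ^ Suc l)) * inverse (p ^ Suc j) ^ i"
    by (simp add: qpoch_Suc)
  finally show ?case .
qed simp

text \<open>The last j factors of (g)_N are reversed by 1 - g p^(N-1-l) = -p^(-l-1) (g p^N) (1 -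
  p^(l+1) / (g p^N)). The product over l is that of \<open>qpoch_inverse_power_prefix\<close>, so in
  Watson's formula the one arising there is absorbed here.\<close>

lemma qpoch_reverse_suffix:
  fixes p :: "'a::field"
  assumes "p \<noteq> 0" "g \<noteq> 0" "j \<le> N"
  shows "(\<Prod>l<j. - inverse (p ^ Suc l)) * (g * p ^ N) ^ j * qpoch g p (N - j) * qpoch (p / (g * p ^ N)) p j
       = qpoch g p N"
  using assms(3)
proof (induction j)
  case (Suc j)
  then obtain r where r: "N = Suc r + j" by (metis add.commute le_Suc_ex add_Suc_right)
  have "(\<Prod>l<Suc j. - inverse (p ^ Suc l)) * (g * p ^ N) ^ Suc j * qpoch g p (N - Suc j) * qpoch (p / (g * p ^ N)) p (Suc j)
    = (\<Prod>l<j. - inverse (p ^ Suc l)) * (g * p ^ N) ^ j * (qpoch g p r * (- inverse (p ^ Suc j) * (g * p ^ N) * (1 - p / (g * p ^ N) * p ^ j))) * qpoch (p / (g * p ^ N)) p j"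
    using r by (simp add: qpoch_Suc mult_ac)
  also have "- inverse (p ^ Suc j) * (g * p ^ N) * (1 - p / (g * p ^ N) * p ^ j) = 1 - g * p ^ r"
    using assms by (simp add: r field_simps power_add)
  also have "qpoch g p r * (1 - g * p ^ r) = qpoch g p (N - j)"
    using r by (simp add: qpoch_Suc)
  finally show ?case using Suc by simp
qed simp

text \<open>Expand \<open>(b)\<^sub>k (c)\<^sub>k / ((Ap/b)\<^sub>k (Ap/c)\<^sub>k)\<close> by the Saalschuetz sum, interchange the two summations,
  and evaluate the inner sum, a terminating \<open>6\<phi>5\<close> series with \<open>A\<close> replaced by \<open>A p ^ (2 j)\<close>.\<close>

theorem watson_transformation:
  fixes A b c d e p :: "'a::field"
  assumes nz: "A \<noteq> 0" "b \<noteq> 0" "c \<noteq> 0" "d \<noteq> 0" "e \<noteq> 0" "p \<noteq> 0"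
    and p1: "\<And>i. 0 < i \<Longrightarrow> p ^ i \<noteq> 1" and A1: "\<And>i. 0 < i \<Longrightarrow> A * p ^ i \<noteq> 1"
    and Ab: "\<And>i. 0 < i \<Longrightarrow> A * p ^ i \<noteq> b" and Ac: "\<And>i. 0 < i \<Longrightarrow> A * p ^ i \<noteq> c"
    and Ad: "\<And>i. 0 < i \<Longrightarrow> A * p ^ i \<noteq> d" and Ae: "\<And>i. 0 < i \<Longrightarrow> A * p ^ i \<noteq> e"
    and Ade: "\<And>i. 0 < i \<Longrightarrow> i \<le> N \<Longrightarrow> A * p ^ i \<noteq> d * e"
  shows "(\<Sum>k\<le>N. (1 - A * (p ^ k)\<^sup>2) * 
             (qpoch A p k * qpoch b p k * qpoch c p k * qpoch d p k * qpoch e p k * qpoch (inverse (p ^ N)) p k)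
              / (qpoch p p k * qpoch (A * p / b) p k * qpoch (A * p / c) p k * qpoch (A * p / d) p k
                  * qpoch (A * p / e) p k * qpoch (A * p ^ Suc N) p k)
              * (A * p / (b * c) * (A * p ^ Suc N / (d * e))) ^ k)
       = (1 - A) * (qpoch (A * p) p N * qpoch (A * p / (d * e)) p N / (qpoch (A * p / d) p N * qpoch (A * p / e) p N))
         * (\<Sum>j\<le>N. qpoch (A * p / (b * c)) p j * qpoch d p j * qpoch e p j * qpoch (inverse (p ^ N)) p j
               / (qpoch p p j * qpoch (A * p / b) p j * qpoch (A * p / c) p j * qpoch (d * e / (A * p ^ N)) p j) * p ^ j)"
proof -
  define X where "X = A * p / (b * c)"
  define g where "g = A * p / (d * e)"
  define \<tau> where "\<tau> j = (\<Prod>l<j. - inverse (p ^ Suc l))" for j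
  define w where "w k = (1 - A * (p ^ k)\<^sup>2) * (qpoch A p k * qpoch d p k * qpoch e p k * qpoch (inverse (p ^ N)) p k)
       / (qpoch p p k * qpoch (A * p / d) p k * qpoch (A * p / e) p k * qpoch (A * p ^ Suc N) p k)
       * (A * p ^ Suc N / (d * e)) ^ k" for k
  define f where "f k j = qpoch (inverse (p ^ k)) p j * qpoch (A * p ^ k) p j * qpoch X p j
              / (qpoch p p j * qpoch (A * p / b) p j * qpoch (A * p / c) p j) * p ^ j" for k j
  define h where "h j = qpoch X p j * qpoch d p j * qpoch e p j * qpoch (inverse (p ^ N)) p j
               / (qpoch p p j * qpoch (A * p / b) p j * qpoch (A * p / c) p j) * p ^ j" for j
  have qp: "qpoch p p k \<noteq> 0" for k
    using p1[of "Suc _"] by (auto simp: qpoch_eq_0_iff)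
  have qA: "qpoch (A * p ^ Suc r) p k \<noteq> 0" for k r
    using A1[of "Suc r + _"] by (auto simp: qpoch_eq_0_iff power_add mult_ac)
  have qd: "qpoch (A * p / d) p k \<noteq> 0" for k
    using Ad[of "Suc _"] nz by (auto simp: qpoch_eq_0_iff field_simps)
  have qe: "qpoch (A * p / e) p k \<noteq> 0" for k
    using Ae[of "Suc _"] nz by (auto simp: qpoch_eq_0_iff field_simps)
  \<comment> \<open>The factor of index i vanishes exactly when A p^(N-i) = d e, so only the
    exponents 1 to N have to be excluded.\<close>
  have qde: "qpoch (p / (g * p ^ N)) p j \<noteq> 0" if "j \<le> N" for j
  proof -
    have ne: "A * p ^ (N - i) \<noteq> d * e" if "i < j" for i using Ade[of "N - i"] that \<open>j \<le> N\<close> by simp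
    hence "p / (g * p ^ N) * p ^ i \<noteq> 1" if "i < j" for i
    proof -
      have "p ^ N = p ^ (N - i) * p ^ i" using that \<open>j \<le> N\<close> by (simp flip: power_add)
      hence "p / (g * p ^ N) * p ^ i = d * e / (A * p ^ (N - i))"
        using nz by (simp add: g_def)
      also have "\<dots> \<noteq> 1" using ne[OF that] nz by (simp add: divide_simps) 
      finally show ?thesis .
    qed
    thus ?thesis by (auto simp: qpoch_eq_0_iff)
  qed
  have inner: "(\<Sum>k\<le>N. w k * f k j) = (1 - A) * (qpoch (A * p) p N * qpoch g p N / (qpoch (A * p / d) p N * qpoch (A * p / e) p N))
       * (h j / qpoch (p / (g * p ^ N)) p j)" if j: "j \<le> N" for j
  proof -
    \<comment> \<open>Starting a very-well-poised series at index j multiplies A by p^(2j), d and e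
      by p^j, and replaces N by N - j. C collects what does not depend on i.\<close>
    define A' where "A' = A * p ^ (2 * j)"
    define d' where "d' = d * p ^ j"
    define e' where "e' = e * p ^ j"
    define C where "C = \<tau> j * h j * qpoch A p (2 * j) * (A * p ^ Suc N / (d * e)) ^ j
        / (qpoch (A * p / d) p j * qpoch (A * p / e) p j * qpoch (A * p ^ Suc N) p j)"
    define t where "t i = (1 - A' * (p ^ i)\<^sup>2) * 
             (qpoch A' p i * qpoch d' p i * qpoch e' p i * qpoch (inverse (p ^ (N - j))) p i
              / (qpoch p p i * qpoch (A' * p / d') p i * qpoch (A' * p / e') p i * qpoch (A' * p ^ Suc (N - j)) p i)
              * (A' * p ^ Suc (N - j) / (d' * e')) ^ i)" for i
    have pN: "p ^ N = p ^ (N - j) * p ^ j" using j by (simp flip: power_add)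
    have A'2: "A' = A * p ^ j * p ^ j" by (simp add: A'_def mult_2 power_add)
    have summand: "w (j + i) * f (j + i) j = C * t i" for i
    proof -
      have 1: "qpoch (inverse (p ^ (j + i))) p j = qpoch p p (j + i) * \<tau> j * inverse (p ^ j) ^ i / qpoch p p i"
        using qpoch_inverse_power_prefix[of p j i] nz qp[of i] by (simp add: \<tau>_def field_simps)
      have 2: "qpoch A p (j + i) * qpoch (A * p ^ (j + i)) p j = qpoch A p (2 * j) * qpoch A' p i"
        unfolding A'_def by (simp flip: qpoch_add add: algebra_simps mult_2_right)
      \<comment> \<open>The power p^(-ij) from the reversal changes the argument to the one that the
        shifted \<open>six_phi_five\<close> sum requires.\<close>
      have 3: "(A * p ^ Suc N / (d * e)) ^ (j + i) * inverse (p ^ j) ^ i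
         = (A * p ^ Suc N / (d * e)) ^ j * (A' * p ^ Suc (N - j) / (d' * e')) ^ i"
      proof -
        have "A * p ^ Suc N / (d * e) * inverse (p ^ j) = A' * p ^ Suc (N - j) / (d' * e')"
          using nz by (simp add: A'2 d'_def e'_def pN field_simps)
        moreover have "x ^ (j + i) * r ^ i = x ^ j * (x * r) ^ i" for x r :: 'a
          by (simp add: power_add power_mult_distrib)
        ultimately show ?thesis by (simp only:)
      qed
      have 4: "qpoch (A * p / d) p (j + i) = qpoch (A * p / d) p j * qpoch (A' * p / d') p i"
        "qpoch (A * p / e) p (j + i) = qpoch (A * p / e) p j * qpoch (A' * p / e') p i"
        "qpoch (A * p ^ Suc N) p (j + i) = qpoch (A * p ^ Suc N) p j * qpoch (A' * p ^ Suc (N - j)) p i"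
        "qpoch (inverse (p ^ N)) p (j + i) = qpoch (inverse (p ^ N)) p j * qpoch (inverse (p ^ (N - j))) p i"
        "qpoch d p (j + i) = qpoch d p j * qpoch d' p i"
        "qpoch e p (j + i) = qpoch e p j * qpoch e' p i"
        unfolding qpoch_add[of _ _ j i] using nz by (simp_all add: A'2 d'_def e'_def pN field_simps)
      have 5: "A * (p ^ (j + i))\<^sup>2 = A' * (p ^ i)\<^sup>2"
        by (simp add: A'_def power_add power_mult_distrib power_mult[symmetric] mult_ac)
      have "w (j + i) * f (j + i) j = (1 - A * (p ^ (j + i))\<^sup>2) * ((qpoch A p (j + i) * qpoch (A * p ^ (j + i)) p j)
         * qpoch d p (j + i) * qpoch e p (j + i) * qpoch (inverse (p ^ N)) p (j + i)
           / (qpoch (A * p / d) p (j + i) * qpoch (A * p / e) p (j + i) * qpoch (A * p ^ Suc N) p (j + i)))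
         * (\<tau> j / qpoch p p i * (qpoch X p j / (qpoch p p j * qpoch (A * p / b) p j * qpoch (A * p / c) p j) * p ^ j))
         * ((A * p ^ Suc N / (d * e)) ^ (j + i) * inverse (p ^ j) ^ i)"
        unfolding w_def f_def 1 using qp[of "j + i"] by (simp add: mult_ac)
      also have "\<dots> = C * t i"
        unfolding 2 3 4 5 C_def t_def h_def by (simp add: mult_ac)
      finally show ?thesis .
    qed
    \<comment> \<open>For k < j the factor (p^(-k))_j is 0.\<close>
    have "(\<Sum>k\<le>N. w k * f k j) = (\<Sum>k\<in>{j..N}. w k * f k j)"
      using nz by (intro sum.mono_neutral_right) (auto simp: f_def qpoch_inverse_power_eq_0)
    also have "\<dots> = (\<Sum>i\<le>N - j. w (j + i) * f (j + i) j)"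
      by (rule sum.reindex_bij_witness[of _ "\<lambda>i. j + i" "\<lambda>k. k - j"]) (use j in auto)
    also have "\<dots> = C * (\<Sum>i\<le>N - j. t i)"
      unfolding summand by (simp add: sum_distrib_left)
    also have "(\<Sum>i\<le>N - j. t i) = (1 - A') * (qpoch (A' * p) p (N - j) * qpoch (A' * p / (d' * e')) p (N - j) 
           / (qpoch (A' * p / d') p (N - j) * qpoch (A' * p / e') p (N - j)))"
      unfolding t_def
    proof (rule six_phi_five)
      fix i :: nat assume i: "0 < i"
      show "p ^ i \<noteq> 1" using p1 i .
      show "A' * p ^ i \<noteq> 1" using A1[of "2 * j + i"] i by (simp add: A'_def power_add mult_ac)
      show "A' * p ^ i \<noteq> d'" using Ad[of "j + i"] i nz by (simp add: A'2 d'_def power_add mult_ac)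
      show "A' * p ^ i \<noteq> e'" using Ae[of "j + i"] i nz by (simp add: A'2 e'_def power_add mult_ac)
    qed (use nz in \<open>auto simp: A'_def d'_def e'_def\<close>)
    also have "A' * p / (d' * e') = g"
      using nz by (simp add: A'2 d'_def e'_def g_def)
    also have "C * ((1 - A') * (qpoch (A' * p) p (N - j) * qpoch g p (N - j) 
           / (qpoch (A' * p / d') p (N - j) * qpoch (A' * p / e') p (N - j))))
       = (qpoch A p (2 * j) * ((1 - A') * qpoch (A' * p) p (N - j))) / qpoch (A * p ^ Suc N) p j
          / ((qpoch (A * p / d) p j * qpoch (A' * p / d') p (N - j)) * (qpoch (A * p / e) p j * qpoch (A' * p / e') p (N - j)))
          * (\<tau> j * (A * p ^ Suc N / (d * e)) ^ j * qpoch g p (N - j)) * h j"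
      unfolding C_def by (simp add: mult_ac)
    \<comment> \<open>The pieces glue to (A)_(N+j+1), which splits again as (1 - A) (Ap)_N (A
      p^(N+1))_j; the last factor cancels against the denominator of C.\<close>
    also have "qpoch A p (2 * j) * ((1 - A') * qpoch (A' * p) p (N - j)) = qpoch A p (2 * j + Suc (N - j))"
      unfolding qpoch_add qpoch_Suc' A'_def ..
    also have "2 * j + Suc (N - j) = Suc (N + j)" using j by simp
    also have "qpoch A p (Suc (N + j)) = (1 - A) * (qpoch (A * p) p N * qpoch (A * p ^ Suc N) p j)"
      unfolding qpoch_Suc' qpoch_add by (simp add: mult_ac)
    also have "qpoch (A * p / d) p j * qpoch (A' * p / d') p (N - j) = qpoch (A * p / d) p N"
      using nz qpoch_add[of "A * p / d" p j "N - j"] j by (simp add: A'2 d'_def mult_ac)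
    also have "qpoch (A * p / e) p j * qpoch (A' * p / e') p (N - j) = qpoch (A * p / e) p N"
      using nz qpoch_add[of "A * p / e" p j "N - j"] j by (simp add: A'2 e'_def mult_ac)
    also have "\<tau> j * (A * p ^ Suc N / (d * e)) ^ j * qpoch g p (N - j) = qpoch g p N / qpoch (p / (g * p ^ N)) p j"
    proof -
      have 1: "A * p ^ Suc N / (d * e) = g * p ^ N" and "g \<noteq> 0" using nz by (simp_all add: g_def)
      show ?thesis unfolding 1 \<tau>_def
        using qpoch_reverse_suffix[of p g j N] nz(6) \<open>g \<noteq> 0\<close> qde[OF j] j by (simp add: eq_divide_eq)
    qed
    finally show ?thesis using qA[of N j] by simp
  qed
  have "(\<Sum>k\<le>N. (1 - A * (p ^ k)\<^sup>2) * 
             (qpoch A p k * qpoch b p k * qpoch c p k * qpoch d p k * qpoch e p k * qpoch (inverse (p ^ N)) p k)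
              / (qpoch p p k * qpoch (A * p / b) p k * qpoch (A * p / c) p k * qpoch (A * p / d) p k
                  * qpoch (A * p / e) p k * qpoch (A * p ^ Suc N) p k)
              * (A * p / (b * c) * (A * p ^ Suc N / (d * e))) ^ k)
      = (\<Sum>k\<le>N. w k * (qpoch b p k * qpoch c p k / (qpoch (A * p / b) p k * qpoch (A * p / c) p k) * X ^ k))"
    by (rule sum.cong[OF refl]) (simp only: w_def X_def power_mult_distrib, simp add: mult_ac)
  also have "\<dots> = (\<Sum>k\<le>N. w k * (\<Sum>j\<le>k. f k j))"
    unfolding f_def X_def by (subst q_saalschutz) (use nz p1 Ab Ac in auto)
  \<comment> \<open>Raising the inner limit to N adds only zero terms and makes the double sum
    rectangular.\<close>
  also have "\<dots> = (\<Sum>k\<le>N. w k * (\<Sum>j\<le>N. f k j))"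
    using nz by (intro sum.cong refl arg_cong2[where f = "(*)"] sum.mono_neutral_left)
       (auto simp: f_def qpoch_inverse_power_eq_0)
  also have "\<dots> = (\<Sum>j\<le>N. \<Sum>k\<le>N. w k * f k j)"
    unfolding sum_distrib_left by (rule sum.swap)
  also have "\<dots> = (\<Sum>j\<le>N. (1 - A) * (qpoch (A * p) p N * qpoch g p N / (qpoch (A * p / d) p N * qpoch (A * p / e) p N))
       * (h j / qpoch (p / (g * p ^ N)) p j))"
    by (intro sum.cong refl inner) simp
  also have "p / (g * p ^ N) = d * e / (A * p ^ N)"
    using nz by (simp add: g_def)
  finally show ?thesis unfolding sum_distrib_left[symmetric] h_def g_def X_def by simp
qed

section \<open>Cyclotomic polynomials\<close>

declare cyclotomic.simps [simp del]

abbreviation root_poly :: "nat \<Rightarrow> int poly" where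
  "root_poly n \<equiv> monom 1 n - 1"

lemma root_poly_mult: "root_poly (d * k) = root_poly d * (\<Sum>i<k. monom 1 d ^ i)"
  using power_diff_1_eq[of "monom 1 d :: int poly" k]
  by (simp add: monom_power)

lemma root_poly_dvd: "d dvd n \<Longrightarrow> root_poly d dvd root_poly n"
  by (auto simp: root_poly_mult elim!: dvdE)

lemma root_poly_neq_0: "n > 0 \<Longrightarrow> root_poly n \<noteq> 0"
  by (auto simp: poly_eq_iff intro!: exI[of _ 0])

lemma const_dvd_root_poly: "n > 0 \<Longrightarrow> [:c:] dvd root_poly n \<Longrightarrow> is_unit c"
  by (auto simp: const_poly_dvd_iff dest!: spec[of _ 0])

text \<open>Z[X] is not Euclidean, but the exponents are: X^m - 1 = X^r (X^(ns) - 1) + (X^r - 1) for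
  m = ns + r.\<close>

lemma dvd_root_poly_gcd:
  "f dvd root_poly m \<Longrightarrow> f dvd root_poly n \<Longrightarrow> f dvd root_poly (gcd m n)"
proof (induction m n rule: gcd_nat_induct)
  case (step m n)
  have "f dvd root_poly (n * (m div n))"
    using step.prems root_poly_dvd dvd_trans by (meson dvd_triv_left)
  moreover have "root_poly m = monom 1 (m mod n) * root_poly (n * (m div n)) + root_poly (m mod n)"
    by (simp add: algebra_simps mult_monom)
  ultimately have "f dvd root_poly (m mod n)"
    using step.prems(1) by (simp only: dvd_add_right_iff dvd_mult)
  thus ?case using step by (simp add: gcd_red_nat[of m n])
qed auto

text \<open>Modulo \<open>x\<^sup>g - 1\<close> the quotient \<open>(x\<^sup>d - 1) / (x\<^sup>g - 1)\<close> is the constant \<open>d / g\<close>, so a common divisor of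
  the two is constant.\<close>

lemma common_divisor_root_quotient_unit:
  assumes "g dvd d" "g < d" "f dvd root_poly g" "f * root_poly g dvd root_poly d"
  shows "is_unit f"
proof -
  obtain k where k: "d = g * k" using assms(1) by blast
  have g: "g > 0" and k0: "k > 0" using assms(2) k by (auto intro: Nat.gr0I)
  let ?s = "\<Sum>i<k. monom 1 g ^ i :: int poly"
  have "f dvd ?s"
    using assms(4) root_poly_neq_0[OF g] unfolding k root_poly_mult by (simp add: mult.commute)
  moreover have "root_poly g dvd ?s - of_nat k"
  proof -
    have "?s - of_nat k = (\<Sum>i<k. monom 1 g ^ i - 1)" by (simp add: sum_subtractf)
    also have "root_poly g dvd \<dots>" by (rule dvd_sum) (simp add: power_diff_1_eq)
    finally show ?thesis .
  qed
  \<comment> \<open>A divisor of the integer k > 0 is constant but not yet a unit; it becomes one by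
    dividing X^g - 1, whose constant coefficient is -1.\<close>
  ultimately have "f dvd of_nat k"
    using assms(3) dvd_trans[of f "root_poly g" "?s - of_nat k"] by (simp only: dvd_diff_right_iff)
  then obtain h where h: "of_nat k = f * h" by blast
  hence "degree f + degree h = 0"
    using k0 degree_mult_eq[of f h] degree_of_nat[of k, where 'a = int] by (cases "f = 0 \<or> h = 0") (auto simp del: degree_of_nat)
  then obtain c where "f = [:c:]" by (auto elim: degree_eq_zeroE)
  thus ?thesis using const_dvd_root_poly[OF g] assms(3) by (simp add: is_unit_const_poly_iff)
qed

lemma prod_dvd_of_pairwise_coprime:
  fixes f :: "'i \<Rightarrow> 'a::semiring_gcd"
  assumes "finite I" "\<And>i. i \<in> I \<Longrightarrow> f i dvd c"
    and "\<And>i j. i \<in> I \<Longrightarrow> j \<in> I \<Longrightarrow> i \<noteq> j \<Longrightarrow> coprime (f i) (f j)"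
  shows "prod f I dvd c"
  using assms
proof (induction I rule: finite_induct)
  case (insert i I)
  have "coprime (f i) (prod f I)"
    using insert by (intro prod_coprime_right) auto
  thus ?case using insert by (auto intro!: divides_mult)
qed simp

text \<open>The point is that the \<open>div\<close> in the recursive definition is exact. For
  proper divisors d of n the Phi_d are pairwise coprime by the induction hypothesis and each divides
  X^n - 1, hence so does their product.\<close>

lemma prod_cyclotomic:
  "n > 0 \<Longrightarrow> (\<Prod>d | d dvd n. cyclotomic d) = root_poly n"
proof (induction n rule: less_induct)
  case (less n)
  let ?I = "{d. d dvd n \<and> d < n}"
  have pos: "d > 0" if "d dvd n" for d using that less.prems by (auto intro: Nat.gr0I)
  have fin: "finite {d. d dvd m}" if "m > 0" for m :: nat using that by simp
  \<comment> \<open>Distinct d and e cannot both equal their gcd, so up to a swap this asymmetric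
    form covers every pair.\<close>
  have cop: "coprime (cyclotomic d) (cyclotomic e)" if de: "d \<in> ?I" "e \<in> ?I" "gcd d e < d" for d e
  proof (rule coprimeI)
    fix f assume f: "f dvd cyclotomic d" "f dvd cyclotomic e"
    have d0: "d > 0" "e > 0" using de pos by auto
    have IH: "(\<Prod>k | k dvd d. cyclotomic k) = root_poly d" "(\<Prod>k | k dvd e. cyclotomic k) = root_poly e"
      "(\<Prod>k | k dvd gcd d e. cyclotomic k) = root_poly (gcd d e)"
      by (rule less.IH; use de d0 in simp)+
    have "f dvd root_poly d" "f dvd root_poly e"
      using f dvd_prodI[OF fin[OF d0(1)], of d cyclotomic] dvd_prodI[OF fin[OF d0(2)], of e cyclotomic]
      unfolding IH by (auto intro: dvd_trans)
    hence 1: "f dvd root_poly (gcd d e)" by (rule dvd_root_poly_gcd)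
    \<comment> \<open>As d does not divide the gcd, Phi_d is a further factor of X^d - 1 besides
      those making up X^gcd - 1.\<close>
    have "cyclotomic d * root_poly (gcd d e) = (\<Prod>k \<in> insert d {k. k dvd gcd d e}. cyclotomic k)"
      unfolding IH[symmetric] using d0 de(3) by (subst prod.insert) (auto dest: dvd_imp_le)
    also have "\<dots> dvd root_poly d"
      unfolding IH(1)[symmetric] by (rule prod_dvd_prod_subset) (use d0 in auto)
    finally have "f * root_poly (gcd d e) dvd root_poly d"
      using f(1) by (meson dvd_trans mult_dvd_mono dvd_refl)
    thus "is_unit f" using common_divisor_root_quotient_unit[of "gcd d e" d f] de 1 by auto
  qed
  have "(\<Prod>d\<in>?I. cyclotomic d) dvd root_poly n"
  proof (rule prod_dvd_of_pairwise_coprime)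
    show "finite ?I" by simp
    fix d assume d: "d \<in> ?I"
    have "cyclotomic d dvd (\<Prod>k | k dvd d. cyclotomic k)"
      using d pos by (intro dvd_prodI) auto
    also have "\<dots> = root_poly d" using d pos by (intro less.IH) auto
    also have "root_poly d dvd root_poly n" using d by (intro root_poly_dvd) auto
    finally show "cyclotomic d dvd root_poly n" .
  next
    fix d e assume de: "d \<in> ?I" "e \<in> ?I" "d \<noteq> e"
    have "gcd d e \<le> d" "gcd d e \<le> e" using de pos by auto
    hence "gcd d e < d \<or> gcd e d < e" using \<open>d \<noteq> e\<close> by (auto simp: gcd.commute)
    thus "coprime (cyclotomic d) (cyclotomic e)"
      using cop[of d e] cop[of e d] de by (auto simp: coprime_commute)
  qed
  hence "cyclotomic n * (\<Prod>d\<in>?I. cyclotomic d) = root_poly n"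
    using less.prems by (subst cyclotomic.simps) auto
  moreover have "{d. d dvd n} = insert n ?I"
    using less.prems by (auto dest: dvd_imp_le)
  ultimately show ?case by simp
qed

lemma cyclotomic_mult_root_poly_dvd:
  assumes "g dvd n" "g < n"
  shows "cyclotomic n * root_poly g dvd root_poly n"
proof -
  have pos: "g > 0" using assms by (auto intro: Nat.gr0I)
  have "cyclotomic n * root_poly g = (\<Prod>k \<in> insert n {k. k dvd g}. cyclotomic k)"
    unfolding prod_cyclotomic[OF pos, symmetric] using assms pos
    by (subst prod.insert) (auto dest: dvd_imp_le)
  also have "\<dots> dvd (\<Prod>k | k dvd n. cyclotomic k)"
    by (rule prod_dvd_prod_subset) (use assms in auto)
  also have "\<dots> = root_poly n" using assms by (intro prod_cyclotomic) auto
  finally show ?thesis .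
qed

lemma cyclotomic_dvd_root_poly: "n > 0 \<Longrightarrow> cyclotomic n dvd root_poly n"
  using prod_cyclotomic[of n] dvd_prodI[of "{d. d dvd n}" n cyclotomic] by auto

text \<open>A common divisor divides X^g - 1 with g = gcd n m < n. Since Phi_n (X^g - 1) divides X^n
  - 1, it also divides (X^n - 1) / (X^g - 1) and is therefore a unit.\<close>

lemma coprime_cyclotomic_root_poly:
  assumes "n > 0" "\<not> n dvd m"
  shows "coprime (cyclotomic n) (root_poly m)"
proof (rule coprimeI)
  fix f assume f: "f dvd cyclotomic n" "f dvd root_poly m"
  have "gcd n m \<noteq> n" using assms by (metis gcd_dvd2)
  hence g: "gcd n m < n" using assms by (simp add: le_neq_implies_less)
  have "f dvd root_poly (gcd n m)"
    using f cyclotomic_dvd_root_poly[OF assms(1)] dvd_trans by (intro dvd_root_poly_gcd) blast+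
  moreover have "f * root_poly (gcd n m) dvd root_poly n"
    using f(1) cyclotomic_mult_root_poly_dvd[of "gcd n m" n] g by (meson dvd_trans mult_dvd_mono dvd_refl gcd_dvd1)
  ultimately show "is_unit f" using g by (intro common_divisor_root_quotient_unit[of "gcd n m" n f]) auto
qed

section \<open>Congruences between rational functions\<close>

text \<open>Membership in the localisation of the polynomial ring at the elements coprime to
  P.\<close>

definition integral_at :: "R \<Rightarrow> R fract \<Rightarrow> bool" where
  "integral_at P x \<longleftrightarrow> (\<exists>N D. D \<noteq> 0 \<and> coprime D P \<and> x = Fract N D)"

definition unit_at :: "R \<Rightarrow> R fract \<Rightarrow> bool" where
  "unit_at P x \<longleftrightarrow> x \<noteq> 0 \<and> integral_at P x \<and> integral_at P (inverse x)"

text \<open>Both sides must be integral, which \<open>cong_rat\<close> does not ask; this makes the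
  relation compatible with products and with quotients by units. Its reflexive instances express
  integrality.\<close>

definition cong_at :: "R \<Rightarrow> R fract \<Rightarrow> R fract \<Rightarrow> bool" where
  "cong_at P x y \<longleftrightarrow> integral_at P x \<and> integral_at P y \<and> (\<exists>z. integral_at P z \<and> x - y = Fract P 1 * z)"

lemma cong_at_imp_cong_rat:
  assumes "cong_at P x y" shows "cong_rat x y P"
proof -
  obtain N D where "D \<noteq> 0" "coprime D P" "x - y = Fract P 1 * Fract N D"
    using assms unfolding cong_at_def integral_at_def by blast
  thus ?thesis unfolding cong_rat_def
    by (intro exI[of _ "P * N"] exI[of _ D]) simp
qed

lemma cong_rat_unit_modulus: "is_unit P \<Longrightarrow> cong_rat x y P"
proof -
  assume P: "is_unit P"
  obtain N D where "x - y = Fract N D" "D \<noteq> 0" by (cases "x - y") auto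
  thus ?thesis using P unfolding cong_rat_def
    by (intro exI[of _ N] exI[of _ D]) (simp add: is_unit_right_imp_coprime unit_imp_dvd)
qed

text \<open>The two hypotheses may come with different fractions. Both are compared with one
  fraction N / D in lowest terms: each modulus divides N, and D divides each denominator, so it is
  coprime to each modulus.\<close>

lemma cong_rat_mult_modulus:
  assumes "coprime P Q" "cong_rat x y P" "cong_rat x y Q"
  shows "cong_rat x y (P * Q)"
proof -
  obtain N D where ND: "x - y = Fract N D" "D \<noteq> 0" "coprime N D"
  proof -
    obtain N0 D0 where 0: "x - y = Fract N0 D0" "D0 \<noteq> 0" by (cases "x - y") auto
    define g where "g = gcd N0 D0"
    have g: "g \<noteq> 0" using 0(2) by (simp add: g_def)
    have e: "g * (N0 div g) = N0" "g * (D0 div g) = D0" by (simp_all only: g_def dvd_mult_div_cancel gcd_dvd1 gcd_dvd2)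
    have "x - y = Fract (N0 div g) (D0 div g)"
      using 0(1) mult_fract_cancel[OF g, of "N0 div g" "D0 div g"] unfolding e by simp
    moreover have "coprime (N0 div g) (D0 div g)" unfolding g_def by (rule div_gcd_coprime) (use 0(2) in simp)
    moreover have "D0 div g \<noteq> 0" using e(2) 0(2) by auto
    ultimately show ?thesis using that by blast
  qed
  have *: "S dvd N \<and> coprime D S" if S: "cong_rat x y S" for S
  proof -
    obtain N' D' where 1: "D' \<noteq> 0" "coprime D' S" "S dvd N'" "x - y = Fract N' D'"
      using S unfolding cong_rat_def by blast
    have eq: "N * D' = N' * D" using eq_fract(1)[OF ND(2) 1(1), of N N'] ND(1) 1(4) by metis
    have cS: "coprime S D'" and cD: "coprime D N" using 1(2) ND(3) by (simp_all only: coprime_commute)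
    have "S dvd N * D'" unfolding eq by (rule dvd_mult2[OF 1(3)])
    hence "S dvd N" by (simp only: coprime_dvd_mult_left_iff[OF cS])
    moreover have "D dvd N * D'" unfolding eq by (rule dvd_triv_right)
    hence "D dvd D'" by (simp only: coprime_dvd_mult_right_iff[OF cD])
    hence "coprime D S" using 1(2) by (rule coprime_divisors[OF _ dvd_refl])
    ultimately show ?thesis by blast
  qed
  have "P * Q dvd N" using *[OF assms(2)] *[OF assms(3)] by (intro divides_mult assms(1)) simp_all
  moreover have "coprime D (P * Q)" using *[OF assms(2)] *[OF assms(3)] by simp
  ultimately show ?thesis using ND(1,2) unfolding cong_rat_def by (intro exI[of _ N] exI[of _ D] conjI)
qed

lemma integral_at_Fract: "coprime D P \<Longrightarrow> D \<noteq> 0 \<Longrightarrow> integral_at P (Fract N D)"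
  unfolding integral_at_def by blast

lemma integral_at_of_R [simp]: "integral_at P (Fract N 1)"
  by (rule integral_at_Fract) auto

lemma integral_at_0 [simp]: "integral_at P 0" and integral_at_1 [simp]: "integral_at P 1"
  by (simp_all add: Zero_fract_def One_fract_def)

lemma integral_at_add: 
  assumes "integral_at P x" "integral_at P y" shows "integral_at P (x + y)"
proof -
  from assms obtain N D N' D' where *: "D \<noteq> 0" "coprime D P" "x = Fract N D" "D' \<noteq> 0" "coprime D' P" "y = Fract N' D'"
    unfolding integral_at_def by blast
  show ?thesis unfolding integral_at_def
    by (rule exI[of _ "N * D' + N' * D"], rule exI[of _ "D * D'"]) (use * in auto)
qed

lemma integral_at_mult: 
  assumes "integral_at P x" "integral_at P y" shows "integral_at P (x * y)"
proof -
  from assms obtain N D N' D' where *: "D \<noteq> 0" "coprime D P" "x = Fract N D" "D' \<noteq> 0" "coprime D' P" "y = Fract N' D'"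
    unfolding integral_at_def by blast
  show ?thesis unfolding integral_at_def
    by (rule exI[of _ "N * N'"], rule exI[of _ "D * D'"]) (use * in auto)
qed

lemma integral_at_uminus: "integral_at P x \<Longrightarrow> integral_at P (- x)"
  using integral_at_mult[OF integral_at_of_R[of P "- 1"], of x]
  by (simp flip: minus_fract One_fract_def)

lemma integral_at_power: "integral_at P x \<Longrightarrow> integral_at P (x ^ k)"
  by (induction k) (auto intro: integral_at_mult)

lemma unit_at_imp_integral: "unit_at P x \<Longrightarrow> integral_at P x"
  and unit_at_imp_integral_inverse: "unit_at P x \<Longrightarrow> integral_at P (inverse x)"
  and unit_at_nonzero: "unit_at P x \<Longrightarrow> x \<noteq> 0"
  by (auto simp: unit_at_def)

lemma unit_at_1 [simp]: "unit_at P 1"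
  by (auto simp: unit_at_def)

lemma unit_at_mult: "unit_at P x \<Longrightarrow> unit_at P y \<Longrightarrow> unit_at P (x * y)"
  by (auto simp: unit_at_def intro: integral_at_mult)

lemma unit_at_inverse: "unit_at P x \<Longrightarrow> unit_at P (inverse x)"
  by (auto simp: unit_at_def)

lemma unit_at_uminus: "unit_at P x \<Longrightarrow> unit_at P (- x)"
  by (auto simp: unit_at_def intro: integral_at_uminus)

lemma unit_at_divide: "unit_at P x \<Longrightarrow> unit_at P y \<Longrightarrow> unit_at P (x / y)"
  unfolding divide_inverse by (intro unit_at_mult unit_at_inverse)

lemma unit_at_power: "unit_at P x \<Longrightarrow> unit_at P (x ^ k)"
  by (induction k) (auto intro: unit_at_mult)

lemma unit_at_qpoch: "(\<And>j. j < k \<Longrightarrow> unit_at P (1 - x * p ^ j)) \<Longrightarrow> unit_at P (qpoch x p k)"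
  by (induction k) (auto simp: qpoch_def intro: unit_at_mult)

lemma integral_at_divide: "integral_at P x \<Longrightarrow> unit_at P y \<Longrightarrow> integral_at P (x / y)"
  unfolding divide_inverse by (intro integral_at_mult unit_at_imp_integral_inverse)

lemma unit_at_Fract:
  assumes "coprime N P" "coprime D P" "\<not> is_unit P" shows "unit_at P (Fract N D)"
proof -
  have "N \<noteq> 0" "D \<noteq> 0" using assms by auto
  thus ?thesis using assms by (auto simp: unit_at_def Zero_fract_def eq_fract intro: integral_at_Fract)
qed

lemma cong_at_refl: "integral_at P x \<Longrightarrow> cong_at P x x"
  unfolding cong_at_def by (auto intro: exI[of _ 0])

lemma cong_at_sym: "cong_at P x y \<Longrightarrow> cong_at P y x"
  unfolding cong_at_def
proof (elim conjE exE, intro conjI)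
  fix z assume "integral_at P z" "x - y = Fract P 1 * z"
  thus "\<exists>z. integral_at P z \<and> y - x = Fract P 1 * z"
    using minus_diff_eq[of x y] by (intro exI[of _ "- z"]) (simp add: integral_at_uminus)
qed

lemma cong_at_imp_integral: "cong_at P x y \<Longrightarrow> integral_at P x" "cong_at P x y \<Longrightarrow> integral_at P y"
  by (auto simp: cong_at_def)

lemma cong_at_trans [trans]:
  assumes "cong_at P x y" "cong_at P y z" shows "cong_at P x z"
proof -
  from assms obtain u v where uv: "integral_at P u" "integral_at P v" "x - y = Fract P 1 * u" "y - z = Fract P 1 * v"
    unfolding cong_at_def by blast
  have "x - z = (x - y) + (y - z)" by simp
  also have "\<dots> = Fract P 1 * (u + v)" unfolding uv(3,4) by (rule distrib_left[symmetric])
  finally show ?thesis using assms integral_at_add[OF uv(1,2)] unfolding cong_at_def by blast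
qed

lemma cong_at_add:
  assumes "cong_at P x x'" "cong_at P y y'" shows "cong_at P (x + y) (x' + y')"
proof -
  from assms obtain u v where uv: "integral_at P u" "integral_at P v" "x - x' = Fract P 1 * u" "y - y' = Fract P 1 * v"
    unfolding cong_at_def by blast
  have "x + y - (x' + y') = (x - x') + (y - y')" by simp
  also have "\<dots> = Fract P 1 * (u + v)" unfolding uv(3,4) by (rule distrib_left[symmetric])
  finally show ?thesis using assms integral_at_add[OF uv(1,2)] unfolding cong_at_def by (blast intro: integral_at_add)
qed

lemma cong_at_mult:
  assumes "cong_at P x x'" "cong_at P y y'" shows "cong_at P (x * y) (x' * y')"
proof -
  from assms obtain u v where uv: "integral_at P u" "integral_at P v" "x - x' = Fract P 1 * u" "y - y' = Fract P 1 * v"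
    unfolding cong_at_def by blast
  have int: "integral_at P x" "integral_at P x'" "integral_at P y" "integral_at P y'"
    using assms by (auto simp: cong_at_def)
  have "x * y - x' * y' = x * (y - y') + (x - x') * y'" by (simp add: algebra_simps)
  also have "\<dots> = Fract P 1 * (x * v + u * y')" unfolding uv(3,4) by (simp add: algebra_simps)
  finally have "x * y - x' * y' = Fract P 1 * (x * v + u * y')" .
  moreover have "integral_at P (x * v + u * y')" "integral_at P (x * y)" "integral_at P (x' * y')"
    by (intro integral_at_add integral_at_mult uv int)+
  ultimately show ?thesis unfolding cong_at_def by blast
qed

lemma cong_at_uminus: "cong_at P x x' \<Longrightarrow> cong_at P (- x) (- x')"
  using cong_at_mult[of P "-1" "-1" x x'] by (auto simp: cong_at_refl integral_at_uminus)

lemma cong_at_diff: "cong_at P x x' \<Longrightarrow> cong_at P y y' \<Longrightarrow> cong_at P (x - y) (x' - y')"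
  using cong_at_add[of P x x' "- y" "- y'"] cong_at_uminus[of P y y'] by simp

lemma cong_at_power: "cong_at P x x' \<Longrightarrow> cong_at P (x ^ k) (x' ^ k)"
  by (induction k) (auto intro: cong_at_mult cong_at_refl)

lemma cong_at_sum: "(\<And>k. k \<in> I \<Longrightarrow> cong_at P (f k) (g k)) \<Longrightarrow> cong_at P (sum f I) (sum g I)"
  by (induction I rule: infinite_finite_induct) (auto intro: cong_at_add cong_at_refl)

lemma cong_at_prod: "(\<And>k. k \<in> I \<Longrightarrow> cong_at P (f k) (g k)) \<Longrightarrow> cong_at P (prod f I) (prod g I)"
  by (induction I rule: infinite_finite_induct) (auto intro: cong_at_mult cong_at_refl)

lemma cong_at_qpoch: "cong_at P x x' \<Longrightarrow> integral_at P p \<Longrightarrow> cong_at P (qpoch x p k) (qpoch x' p k)"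
  unfolding qpoch_def
  by (intro cong_at_prod cong_at_diff cong_at_mult cong_at_refl integral_at_power integral_at_1)

lemma integral_at_qpoch: "integral_at P x \<Longrightarrow> integral_at P p \<Longrightarrow> integral_at P (qpoch x p k)"
  using cong_at_imp_integral(1)[OF cong_at_qpoch[OF cong_at_refl]] .

text \<open>y = x (1 - P z / x), and the second factor has a numerator D - P N, which is coprime to
  P because D is.\<close>

lemma unit_at_cong:
  assumes "unit_at P x" "cong_at P x y" "\<not> is_unit P"
  shows "unit_at P y"
proof -
  obtain z where z: "integral_at P z" "x - y = Fract P 1 * z" using assms(2) by (auto simp: cong_at_def)
  have x: "x \<noteq> 0" "integral_at P (inverse x)" "integral_at P x" using assms(1) by (auto simp: unit_at_def)
  obtain N D where ND: "D \<noteq> 0" "coprime D P" "z * inverse x = Fract N D" 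
    using integral_at_mult[OF z(1) x(2)] unfolding integral_at_def by blast
  have "y = x - Fract P 1 * z" using z(2) by (simp add: algebra_simps)
  also have "\<dots> = x * (1 - Fract P 1 * (z * inverse x))" using x by (simp add: field_simps)
  also have "1 - Fract P 1 * (z * inverse x) = Fract (D - P * N) D"
    using ND by (simp add: One_fract_def)
  finally have y: "y = x * Fract (D - P * N) D" .
  have "coprime (D - P * N) P"
  proof (rule coprimeI)
    fix f assume f: "f dvd D - P * N" "f dvd P"
    have "f dvd (D - P * N) + P * N" using f by (intro dvd_add) auto
    thus "is_unit f" using f(2) ND(2) by (simp add: coprime_common_divisor)
  qed
  hence "unit_at P (Fract (D - P * N) D)" using ND assms(3) by (intro unit_at_Fract)
  thus ?thesis unfolding y using assms(1) by (intro unit_at_mult)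
qed

lemma cong_at_divide:
  assumes "\<not> is_unit P" "cong_at P x x'" "cong_at P y y'" "unit_at P y"
  shows "cong_at P (x / y) (x' / y')"
proof -
  have y': "unit_at P y'" using unit_at_cong[OF assms(4,3,1)] .
  have nz: "y \<noteq> 0" "y' \<noteq> 0" using assms(4) y' by (auto simp: unit_at_def)
  have "cong_at P (x * y' * inverse (y * y')) (x' * y * inverse (y * y'))"
    by (intro cong_at_mult cong_at_refl unit_at_imp_integral_inverse unit_at_mult y' assms(2,4) cong_at_sym[OF assms(3)])
  moreover have "x * y' * inverse (y * y') = x / y" "x' * y * inverse (y * y') = x' / y'"
    using nz by (simp_all add: field_simps)
  ultimately show ?thesis by simp
qed

lemma cong_at_inverse:
  assumes "\<not> is_unit P" "cong_at P y y'" "unit_at P y"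
  shows "cong_at P (inverse y) (inverse y')"
  using cong_at_divide[OF assms(1) cong_at_refl[of P 1] assms(2,3)] by (simp add: divide_inverse)

section \<open>Coprimality by evaluation\<close>

locale ring_morphism =
  fixes h :: "'a::comm_ring_1 \<Rightarrow> 'b::comm_ring_1"
  assumes hom_add: "h (x + y) = h x + h y" and hom_mult: "h (x * y) = h x * h y" and hom_1: "h 1 = 1"
begin

lemma hom_0: "h 0 = 0"
  using hom_add[of 0 0] by simp

lemma hom_uminus: "h (- x) = - h x"
  using hom_add[of x "- x"] by (simp add: hom_0 eq_neg_iff_add_eq_0 add.commute)

lemma hom_diff: "h (x - y) = h x - h y"
  using hom_add[of x "- y"] by (simp add: hom_uminus)

lemma hom_power: "h (x ^ k) = h x ^ k"
  by (induction k) (simp_all add: hom_1 hom_mult)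

lemma hom_dvd: "x dvd y \<Longrightarrow> h x dvd h y"
  by (auto simp: hom_mult elim!: dvdE)

lemmas hom_simps = hom_add hom_mult hom_1 hom_0 hom_uminus hom_diff hom_power

text \<open>One layer of the nested polynomial ring. As \<open>eval_at\<close> is again a morphism,
  the construction iterates through all layers.\<close>

definition eval_at :: "'b \<Rightarrow> 'a poly \<Rightarrow> 'b" where
  "eval_at x f = poly (map_poly h f) x"

lemma eval_at_0: "eval_at x 0 = 0"
  by (simp add: eval_at_def)

lemma eval_at_pCons: "eval_at x (pCons a f) = h a + x * eval_at x f"
  by (simp add: eval_at_def map_poly_pCons hom_0)

lemma eval_at_add: "eval_at x (f + g) = eval_at x f + eval_at x g"
  by (induction f g rule: poly_induct2) (simp_all add: eval_at_0 eval_at_pCons hom_add algebra_simps)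

lemma eval_at_smult: "eval_at x (smult a f) = h a * eval_at x f"
  by (induction f) (simp_all add: eval_at_0 eval_at_pCons hom_mult algebra_simps)

lemma ring_morphism_eval_at: "ring_morphism (eval_at x)"
proof
  show "eval_at x (f * g) = eval_at x f * eval_at x g" for f g
    by (induction f) (simp_all add: eval_at_0 eval_at_pCons eval_at_add eval_at_smult hom_0 algebra_simps)
qed (simp_all add: eval_at_add one_pCons eval_at_pCons eval_at_0 hom_1)

end

lemma ring_morphism_id: "ring_morphism (\<lambda>x. x)"
  by unfold_locales auto

lemma ring_morphism_of_int: "ring_morphism of_int"
  by unfold_locales auto

text \<open>The morphism h on Z[q] stays free: a real evaluation serves the linear moduli, the
  identity leaves the cyclotomic polynomial intact.\<close>

lemma exists_evaluation:
  fixes h :: "int poly \<Rightarrow> 'b::comm_ring_1"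
  assumes "ring_morphism h"
  obtains E :: "R \<Rightarrow> 'b" where "ring_morphism E" "\<And>f. E [:[:[:[:f:]:]:]:] = h f"
    "E Xq = h [:0, 1:]" "E Xa = a" "E Xb = b" "E Xc = c" "E Xd = d"
proof -
  interpret h: ring_morphism h by fact
  interpret h1: ring_morphism "h.eval_at a" by (rule h.ring_morphism_eval_at)
  interpret h2: ring_morphism "h1.eval_at b" by (rule h1.ring_morphism_eval_at)
  interpret h3: ring_morphism "h2.eval_at c" by (rule h2.ring_morphism_eval_at)
  note s = h.eval_at_pCons h.eval_at_0 h1.eval_at_pCons h1.eval_at_0 h2.eval_at_pCons h2.eval_at_0
     h3.eval_at_pCons h3.eval_at_0 h.hom_0 h.hom_1[unfolded one_pCons] Xq_def Xa_def Xb_def Xc_def Xd_def one_pCons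
  show ?thesis
    by (rule that[OF h3.ring_morphism_eval_at[of d]]) (simp_all add: s)
qed

lemma exists_real_evaluation:
  obtains E :: "R \<Rightarrow> real" where "ring_morphism E" "E Xq = q" "E Xa = a" "E Xb = b" "E Xc = c" "E Xd = d"
proof -
  interpret i: ring_morphism "of_int :: int \<Rightarrow> real" by (rule ring_morphism_of_int)
  obtain E :: "R \<Rightarrow> real" where E: "ring_morphism E" "E Xq = i.eval_at q [:0, 1:]" "E Xa = a" "E Xb = b" "E Xc = c" "E Xd = d"
    using exists_evaluation[OF i.ring_morphism_eval_at[of q], of a b c d] by metis
  show ?thesis by (rule that[of E]) (use E in \<open>simp_all add: i.eval_at_pCons i.eval_at_0\<close>)
qed

text \<open>A prime is coprime to whatever it does not divide, and a zero of P at which D is nonzero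
  rules out divisibility.\<close>

lemma coprime_prime_of_evaluation:
  assumes "prime_elem P" "ring_morphism E" "E P = 0" "E D \<noteq> 0"
  shows "coprime D (P :: R)"
proof -
  interpret ring_morphism E by fact
  have "\<not> P dvd D" using hom_dvd[of P D] assms by auto
  thus ?thesis using assms(1) prime_elem_imp_coprime coprime_commute by blast
qed

lemma dvd_const_polyE:
  fixes f :: "'a::idom poly"
  assumes "f dvd [:c:]" "c \<noteq> 0"
  obtains g where "f = [:g:]" "g dvd c"
proof -
  have "degree f = 0" using dvd_imp_degree_le[OF assms(1)] assms(2) by simp
  then obtain g where "f = [:g:]" by (rule degree_eq_zeroE)
  thus ?thesis using assms that by simp
qed

text \<open>Degrees in a, b, c, d show that a divisor of a polynomial in q alone lies in Z[q]. E
  fixes it, so it divides both E D and p.\<close>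

lemma coprime_const_of_evaluation:
  assumes "ring_morphism E" "\<And>f. E [:[:[:[:f:]:]:]:] = f" "coprime (E D) p" "p \<noteq> 0"
  shows "coprime D ([:[:[:[:p:]:]:]:] :: R)"
proof (rule coprimeI)
  interpret ring_morphism E by fact
  fix f assume f: "f dvd D" "f dvd [:[:[:[:p:]:]:]:]"
  obtain f3 where 3: "f = [:f3:]" "f3 dvd [:[:[:p:]:]:]" by (rule dvd_const_polyE[OF f(2)]) (use assms(4) in auto)
  obtain f2 where 2: "f3 = [:f2:]" "f2 dvd [:[:p:]:]" by (rule dvd_const_polyE[OF 3(2)]) (use assms(4) in auto)
  obtain f1 where 1: "f2 = [:f1:]" "f1 dvd [:p:]" by (rule dvd_const_polyE[OF 2(2)]) (use assms(4) in auto)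
  obtain f0 where 0: "f1 = [:f0:]" "f0 dvd p" by (rule dvd_const_polyE[OF 1(2)]) (use assms(4) in auto)
  have "f0 dvd E D" using hom_dvd[OF f(1)] assms(2)[of f0] by (simp add: 3(1) 2(1) 1(1) 0(1))
  hence "is_unit f0" using assms(3) 0(2) by (simp add: coprime_common_divisor)
  thus "is_unit f" by (simp add: 3(1) 2(1) 1(1) 0(1) is_unit_const_poly_iff)
qed

lemma const_poly_power: "[:c:] ^ k = [:c ^ k:]"
  by (induction k) (simp_all add: one_pCons mult.commute)

lemma Xq_power: "Xq ^ k = [:[:[:[:[:0, 1:] ^ k:]:]:]:]"
  by (simp add: Xq_def const_poly_power)

text \<open>Linear in a with one coefficient equal to 1, hence primitive and prime; the outer
  variables only wrap it as a constant. The next two factors are treated alike.\<close>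

lemma prime_elem_a_minus: "prime_elem (Xa - Xq ^ n)"
proof -
  have "Xa - Xq ^ n = [:[:[:[:- ([:0, 1:] ^ n), 1:]:]:]:]"
    unfolding Xq_power by (simp add: Xa_def)
  moreover have "prime_elem [:- ([:0, 1:] ^ n) :: int poly, 1:]"
    by (rule prime_elem_linear_poly) auto
  ultimately show ?thesis by (simp add: prime_elem_const_poly_iff)
qed

lemma prime_elem_1_minus_a: "prime_elem (1 - Xa * Xq ^ n)"
proof -
  have "1 - Xa * Xq ^ n = [:[:[:[:1, - ([:0, 1:] ^ n):]:]:]:]"
    unfolding Xq_power by (simp add: Xa_def one_pCons)
  moreover have "prime_elem [:1, - ([:0, 1:] ^ n) :: int poly:]"
    by (rule prime_elem_linear_poly) auto
  ultimately show ?thesis by (simp add: prime_elem_const_poly_iff)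
qed

lemma prime_elem_b_minus: "prime_elem (Xb - Xq ^ n)"
proof -
  have "Xb - Xq ^ n = [:[:[:- [:[:0, 1:] ^ n:], 1:]:]:]"
    unfolding Xq_power by (simp add: Xb_def)
  moreover have "prime_elem [:- [:[:0, 1:] ^ n:] :: int poly poly, 1:]"
    by (rule prime_elem_linear_poly) auto
  ultimately show ?thesis by (simp add: prime_elem_const_poly_iff)
qed

text \<open>The polynomials required to be coprime to the modulus are the factors of all denominators of the theorem.\<close>

locale good_modulus =
  fixes n :: nat and P :: R
  assumes not_unit: "\<not> is_unit P"
    and coprime_q: "coprime Xq P" and coprime_a: "coprime Xa P" and coprime_b: "coprime Xb P"
    and coprime_c: "coprime Xc P" and coprime_d: "coprime Xd P"
    and coprime_1q: "coprime (1 - Xq) P"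
    and coprime_1_q: "\<And>j. 0 < j \<Longrightarrow> j < n \<Longrightarrow> coprime (1 - Xq ^ (2 * j)) P"
    and coprime_a_q: "\<And>j. 0 < j \<Longrightarrow> coprime (Xa - Xq ^ (2 * j)) P"
    and coprime_1_aq: "\<And>j. 0 < j \<Longrightarrow> coprime (1 - Xa * Xq ^ (2 * j)) P"
    and coprime_1_bq: "\<And>j. 0 < j \<Longrightarrow> coprime (1 - Xb * Xq ^ (2 * j)) P"
    and coprime_bq_q: "\<And>j. coprime (Xb * Xq ^ 2 - Xq ^ (2 * j)) P"
    and coprime_c_q: "\<And>j. 0 < j \<Longrightarrow> coprime (Xc - Xq ^ (2 * j)) P"
    and coprime_d_q: "\<And>j. 0 < j \<Longrightarrow> coprime (Xd - Xq ^ (2 * j)) P"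
    and coprime_a_b: "coprime (Xa - Xb) P" and coprime_1_ab: "coprime (1 - Xa * Xb) P"

section \<open>Coprimality of the denominators to each factor of the modulus\<close>

lemma parity_power_neq: "odd n \<Longrightarrow> (2::real) ^ n \<noteq> 2 ^ (2 * j)"
  by (auto simp: power_inject_exp)

text \<open>With \<open>q = 2\<close> and \<open>-1\<close> for the free variables, non-vanishing is a matter of signs and of the parity
  of exponents of 2.\<close>

lemma good_modulus_prime:
  assumes P: "prime_elem P" "ring_morphism E" "E P = (0 :: real)" and q: "E Xq = 2"
    and cd: "E Xc = -1" "E Xd = -1" and ab: "E Xa > 0 \<and> E Xb = -1 \<or> E Xa = -1 \<and> E Xb > 0"
    and Ea: "\<And>j. 0 < j \<Longrightarrow> E Xa \<noteq> 2 ^ (2 * j)" "\<And>j. 0 < j \<Longrightarrow> E Xa * 2 ^ (2 * j) \<noteq> 1"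
    and Eb: "\<And>j. 0 < j \<Longrightarrow> E Xb * 2 ^ (2 * j) \<noteq> 1" "\<And>j. E Xb * 4 \<noteq> 2 ^ (2 * j)"
  shows "good_modulus n P"
proof -
  interpret ring_morphism E by fact
  note cop = coprime_prime_of_evaluation[OF P]
  have pos: "- 1 - 2 ^ k \<noteq> (0::real)" for k :: nat
    using zero_less_power[of "2::real" k] by linarith
  show ?thesis
  proof
    show "\<not> is_unit P" using P(1) by (simp add: prime_elem_def)
    show "coprime Xa P" "coprime Xb P" "coprime (Xa - Xb) P" "coprime (1 - Xa * Xb) P"
      using ab by (auto intro!: cop simp: hom_simps)
    show "coprime (1 - Xq ^ (2 * j)) P" if "0 < j" for j
    proof -
      have "1 < (2::real) ^ (2 * j)" using that by (intro one_less_power) auto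
      hence "1 - (2::real) ^ (2 * j) \<noteq> 0" by linarith
      thus ?thesis by (intro cop) (simp only: hom_simps q not_False_eq_True)
    qed
    show "coprime (Xc - Xq ^ (2 * j)) P" "coprime (Xd - Xq ^ (2 * j)) P" for j
      using pos[of "2 * j"] by (auto intro!: cop simp: hom_simps q cd)
  qed (use Ea Eb in \<open>auto intro!: cop simp: hom_simps q cd\<close>)
qed

text \<open>The point a = 2^n, q = 2 is a zero of the modulus; the delicate factors a - q^(2j) are
  nonzero there because n is odd.\<close>

lemma good_modulus_a_minus:
  assumes "odd n" shows "good_modulus n (Xa - Xq ^ n)"
proof -
  obtain E :: "R \<Rightarrow> real" where E: "ring_morphism E" "E Xq = 2" "E Xa = 2 ^ n" "E Xb = -1" "E Xc = -1" "E Xd = -1"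
    using exists_real_evaluation[of 2 "2 ^ n" "-1" "-1" "-1"] by blast
  interpret ring_morphism E by fact
  have p: "- 4 \<noteq> (2::real) ^ k" "- (2 ^ k) \<noteq> (1::real)" for k using zero_less_power[of "2::real" k] by linarith+
  have "(2::real) ^ (n + 2 * j) \<noteq> 2 ^ 0" if "0 < j" for j using that by (subst power_inject_exp) auto
  thus ?thesis using parity_power_neq[OF assms] p
    by (intro good_modulus_prime[OF prime_elem_a_minus E(1)]) (simp_all add: hom_simps E power_add)
qed

text \<open>At a = 2^(-n) the factors decided by parity are 1 - a q^(2j).\<close>

lemma good_modulus_1_minus_a:
  assumes "odd n" shows "good_modulus n (1 - Xa * Xq ^ n)"
proof -
  obtain E :: "R \<Rightarrow> real" where E: "ring_morphism E" "E Xq = 2" "E Xa = inverse (2 ^ n)" "E Xb = -1" "E Xc = -1" "E Xd = -1"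
    using exists_real_evaluation[of 2 "inverse (2 ^ n)" "-1" "-1" "-1"] by blast
  interpret ring_morphism E by fact
  have p: "- 4 \<noteq> (2::real) ^ k" "- (2 ^ k) \<noteq> (1::real)" for k using zero_less_power[of "2::real" k] by linarith+
  have *: "(2::real) ^ (n + 2 * j) \<noteq> 2 ^ 0" if "0 < j" for j using that by (subst power_inject_exp) auto
  have 1: "inverse (2 ^ n) \<noteq> (2::real) ^ (2 * j)" if "0 < j" for j
    using *[OF that] by (simp add: power_add field_simps)
  have 2: "inverse (2 ^ n) * (2::real) ^ (2 * j) \<noteq> 1" for j
    using parity_power_neq[OF assms, of j] by (simp add: field_simps)
  show ?thesis using 1 2 p
    by (intro good_modulus_prime[OF prime_elem_1_minus_a E(1)]) (simp_all add: hom_simps E)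
qed

text \<open>At b = 2^n the factors decided by parity are b q^2 - q^(2j), since n + 2 is odd.\<close>

lemma good_modulus_b_minus:
  assumes "odd n" shows "good_modulus n (Xb - Xq ^ n)"
proof -
  obtain E :: "R \<Rightarrow> real" where E: "ring_morphism E" "E Xq = 2" "E Xa = -1" "E Xb = 2 ^ n" "E Xc = -1" "E Xd = -1"
    using exists_real_evaluation[of 2 "-1" "2 ^ n" "-1" "-1"] by blast
  interpret ring_morphism E by fact
  have p: "- 1 \<noteq> (2::real) ^ k" "- (2 ^ k) \<noteq> (1::real)" for k using zero_less_power[of "2::real" k] by linarith+
  have *: "(2::real) ^ (n + 2 * j) \<noteq> 2 ^ 0" if "0 < j" for j using that by (subst power_inject_exp) auto
  have 4: "2 ^ n * 4 \<noteq> (2::real) ^ (2 * j)" for j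
    using parity_power_neq[of "n + 2" j] assms by (simp add: power_add)
  show ?thesis using * 4 p
    by (intro good_modulus_prime[OF prime_elem_b_minus E(1)]) (simp_all add: hom_simps E power_add)
qed

lemma cyclotomic_neq_0: "n > 0 \<Longrightarrow> cyclotomic n \<noteq> 0"
  using cyclotomic_dvd_root_poly[of n] root_poly_neq_0[of n] by auto

lemma coprime_X_cyclotomic: "n > 0 \<Longrightarrow> coprime [:0, 1:] (cyclotomic n)"
proof (rule coprimeI)
  fix f assume n: "n > 0" and f: "f dvd [:0, 1:]" "f dvd cyclotomic n"
  have "f dvd root_poly n" using f(2) cyclotomic_dvd_root_poly[OF n] dvd_trans by blast
  moreover have "f dvd monom 1 n" using f(1) n by (simp add: monom_altdef dvd_power_same dvd_trans[OF f(1)])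
  ultimately show "is_unit f" using dvd_diff_right_iff by blast
qed

lemma coprime_cyclo_q:
  assumes n: "n > 0" and "ring_morphism E" "\<And>f. E [:[:[:[:f:]:]:]:] = f" "E D = u * [:0, 1:] ^ k" "is_unit u"
  shows "coprime D (cyclo_q n)"
  unfolding cyclo_q_def
proof (rule coprime_const_of_evaluation[OF assms(2,3)])
  show "coprime (E D) (cyclotomic n)"
    using coprime_X_cyclotomic[OF n] assms(5) unfolding assms(4) by (simp add: is_unit_left_imp_coprime)
qed (use n cyclotomic_neq_0 in auto)

lemma coprime_1_minus_q_cyclo_q:
  assumes "n > 0" "\<not> n dvd m"
  shows "coprime (1 - Xq ^ m) (cyclo_q n)"
proof -
  obtain E :: "R \<Rightarrow> int poly" where E: "ring_morphism E" "\<And>f. E [:[:[:[:f:]:]:]:] = f"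
      "E Xq = [:0, 1:]" "E Xa = 0" "E Xb = 0" "E Xc = 0" "E Xd = 0"
    using exists_evaluation[OF ring_morphism_id, of 0 0 0 0] by blast
  interpret ring_morphism E by fact
  have "E (1 - Xq ^ m) = - root_poly m" by (simp add: hom_simps E monom_altdef)
  hence "coprime (E (1 - Xq ^ m)) (cyclotomic n)"
    using coprime_cyclotomic_root_poly[OF assms] by (simp only: coprime_minus_right_iff coprime_commute)
  thus ?thesis unfolding cyclo_q_def
    using assms cyclotomic_neq_0 by (intro coprime_const_of_evaluation[OF E(1,2)]) auto
qed

text \<open>Values 0 and 1 suffice: for instance a - q^k becomes -q^k and 1 - a q^k becomes 1 at a =
  0. Several points are used because a, b, c, d themselves must be sent to 1.\<close>

lemma coprime_linear_cyclo_q: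
  assumes n: "n > 0"
  shows "coprime Xq (cyclo_q n)" "coprime Xa (cyclo_q n)" "coprime Xb (cyclo_q n)" "coprime Xc (cyclo_q n)"
    "coprime Xd (cyclo_q n)" "coprime (Xa - Xb) (cyclo_q n)" "coprime (1 - Xa * Xb) (cyclo_q n)"
    "coprime (Xa - Xq ^ k) (cyclo_q n)" "coprime (Xb - Xq ^ k) (cyclo_q n)" "coprime (Xc - Xq ^ k) (cyclo_q n)" "coprime (Xd - Xq ^ k) (cyclo_q n)"
    "coprime (1 - Xa * Xq ^ k) (cyclo_q n)" "coprime (1 - Xb * Xq ^ k) (cyclo_q n)"
    "coprime (Xb * Xq ^ 2 - Xq ^ k) (cyclo_q n)"
proof -
  obtain E :: "R \<Rightarrow> int poly" where E: "ring_morphism E" "\<And>f. E [:[:[:[:f:]:]:]:] = f"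
      "E Xq = [:0, 1:]" "E Xa = 0" "E Xb = 0" "E Xc = 0" "E Xd = 0"
    using exists_evaluation[OF ring_morphism_id, of 0 0 0 0] by blast
  obtain E' :: "R \<Rightarrow> int poly" where E': "ring_morphism E'" "\<And>f. E' [:[:[:[:f:]:]:]:] = f"
      "E' Xq = [:0, 1:]" "E' Xa = 1" "E' Xb = 0" "E' Xc = 1" "E' Xd = 1"
    using exists_evaluation[OF ring_morphism_id, of 1 0 1 1] by blast
  obtain E2 :: "R \<Rightarrow> int poly" where E2: "ring_morphism E2" "\<And>f. E2 [:[:[:[:f:]:]:]:] = f"
      "E2 Xq = [:0, 1:]" "E2 Xa = 0" "E2 Xb = 1" "E2 Xc = 1" "E2 Xd = 1"
    using exists_evaluation[OF ring_morphism_id, of 0 1 1 1] by blast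
  interpret E: ring_morphism E by fact
  interpret E': ring_morphism E' by fact
  interpret E2: ring_morphism E2 by fact
  note c = coprime_cyclo_q[OF n E(1,2)] coprime_cyclo_q[OF n E'(1,2)] coprime_cyclo_q[OF n E2(1,2)]
  show "coprime Xq (cyclo_q n)" by (rule c(1)[of _ 1 1]) (simp_all add: E)
  show "coprime Xa (cyclo_q n)" "coprime Xc (cyclo_q n)" "coprime Xd (cyclo_q n)" "coprime (Xa - Xb) (cyclo_q n)"
    by (rule c(2)[of _ 1 0]; simp add: E' E'.hom_simps)+
  show "coprime Xb (cyclo_q n)" by (rule c(3)[of _ 1 0]) (simp_all add: E2)
  show "coprime (1 - Xa * Xb) (cyclo_q n)" "coprime (1 - Xa * Xq ^ k) (cyclo_q n)" "coprime (1 - Xb * Xq ^ k) (cyclo_q n)"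
    by (rule c(1)[of _ 1 0]; simp add: E E.hom_simps)+
  show "coprime (Xa - Xq ^ k) (cyclo_q n)" "coprime (Xb - Xq ^ k) (cyclo_q n)" "coprime (Xc - Xq ^ k) (cyclo_q n)" "coprime (Xd - Xq ^ k) (cyclo_q n)"
       "coprime (Xb * Xq ^ 2 - Xq ^ k) (cyclo_q n)"
    by (rule c(1)[of _ "- 1" k]; simp add: E E.hom_simps)+
qed

lemma good_modulus_cyclo_q:
  assumes "odd n" "n > 1" "\<not> is_unit (cyclo_q n)"
  shows "good_modulus n (cyclo_q n)"
proof
  show "\<not> is_unit (cyclo_q n)" by fact
  show "coprime (1 - Xq) (cyclo_q n)" using coprime_1_minus_q_cyclo_q[of n 1] assms by simp
  show "coprime (1 - Xq ^ (2 * j)) (cyclo_q n)" if "0 < j" "j < n" for j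
  proof (rule coprime_1_minus_q_cyclo_q)
    \<comment> \<open>For odd n, n dividing 2j would divide j, which is impossible for 0 < j <
      n.\<close>
    have "coprime n 2" using assms(1) by simp
    thus "\<not> n dvd 2 * j" using that by (auto simp: coprime_dvd_mult_right_iff dest: dvd_imp_le)
  qed (use assms in auto)
qed (use assms coprime_linear_cyclo_q in auto)

section \<open>The linear factors of the modulus\<close>

definition lhs_term :: "'a::field \<Rightarrow> 'a \<Rightarrow> 'a \<Rightarrow> 'a \<Rightarrow> 'a \<Rightarrow> nat \<Rightarrow> 'a" where
  "lhs_term q a b c d k = qint q (4 * int k - 1)
       * (qpoch (a / q) (q ^ 2) k * qpoch (inverse (q * a)) (q ^ 2) k
          * qpoch (inverse (q * b)) (q ^ 2) k * qpoch (c / q) (q ^ 2) k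
          * qpoch (d / q) (q ^ 2) k * qpoch (inverse q) (q ^ 2) k)
       / (qpoch (q ^ 2 / a) (q ^ 2) k * qpoch (a * q ^ 2) (q ^ 2) k
          * qpoch (b * q ^ 2) (q ^ 2) k * qpoch (q ^ 2 / c) (q ^ 2) k
          * qpoch (q ^ 2 / d) (q ^ 2) k * qpoch (q ^ 2) (q ^ 2) k)
       * (b * q ^ 7 / (c * d)) ^ k"

definition rhs_term :: "'a::field \<Rightarrow> 'a \<Rightarrow> 'a \<Rightarrow> 'a \<Rightarrow> 'a \<Rightarrow> nat \<Rightarrow> 'a" where
  "rhs_term q a b c d k =
        (qpoch (a / q) (q ^ 2) k * qpoch (inverse (q * a)) (q ^ 2) k
         * qpoch (inverse (q * b)) (q ^ 2) k * qpoch (q ^ 3 / (c * d)) (q ^ 2) k)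
        / (qpoch (q ^ 2) (q ^ 2) k * qpoch (inverse (q ^ 2 * b)) (q ^ 2) k
           * qpoch (q ^ 2 / c) (q ^ 2) k * qpoch (q ^ 2 / d) (q ^ 2) k)
        * q ^ (2 * k)"

text \<open>With A = 1/q and p = q^2 this is A p^(2k): up to 1/(1 - q), the q-integer [4k - 1] is
  the very-well-poised factor.\<close>

lemma powi_4k_minus_1: "q \<noteq> 0 \<Longrightarrow> q powi (4 * int k - 1) = inverse q * ((q ^ 2) ^ k) ^ 2" for q :: "'a::field"
proof -
  assume "q \<noteq> 0"
  hence "q powi (4 * int k - 1) = q powi (int (4 * k)) / q" by (simp add: power_int_diff)
  also have "q powi (int (4 * k)) = ((q ^ 2) ^ k) ^ 2"
    by (simp only: power_int_of_nat flip: power_mult) (simp add: mult.commute mult.left_commute)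
  finally show ?thesis by (simp add: divide_inverse mult.commute)
qed

text \<open>Here p = q^2 and A = 1/q, the top parameters are c/q, d/q, x/q, y/q, and p^(-N) =
  q^(-n-1). The pair x, y will be q^n, 1/b or a, 1/a, depending on the variable specialised; c, d is
  the pair expanded by the Saalschuetz sum.\<close>

lemma watson_specialised:
  fixes q x y c d :: "'a::field"
  assumes N: "2 * N = Suc n" and nz: "q \<noteq> 0" "x \<noteq> 0" "y \<noteq> 0" "c \<noteq> 0" "d \<noteq> 0"
    and q1: "\<And>i. 0 < i \<Longrightarrow> q ^ i \<noteq> 1"
    and xq: "\<And>i. x \<noteq> q ^ (2 * i)" and yq: "\<And>i. y \<noteq> q ^ (2 * i)"
    and cq: "\<And>i. c \<noteq> q ^ (2 * i)" and dq: "\<And>i. d \<noteq> q ^ (2 * i)"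
    and xyq: "\<And>i. x * y \<noteq> q ^ (2 * i + 1)"
  shows "(\<Sum>k\<le>N. qint q (4 * int k - 1) * (qpoch (x / q) (q ^ 2) k * qpoch (y / q) (q ^ 2) k 
            * qpoch (inverse (q * q ^ n)) (q ^ 2) k * qpoch (c / q) (q ^ 2) k * qpoch (d / q) (q ^ 2) k * qpoch (inverse q) (q ^ 2) k)
         / (qpoch (q ^ 2 / x) (q ^ 2) k * qpoch (q ^ 2 / y) (q ^ 2) k * qpoch (q ^ n * q ^ 2) (q ^ 2) k
            * qpoch (q ^ 2 / c) (q ^ 2) k * qpoch (q ^ 2 / d) (q ^ 2) k * qpoch (q ^ 2) (q ^ 2) k)
         * (q ^ n * q ^ 7 / (x * y * c * d)) ^ k)
     = (1 - inverse q) / (1 - q) * (qpoch q (q ^ 2) N * qpoch (q ^ 3 / (x * y)) (q ^ 2) N 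
          / (qpoch (q ^ 2 / x) (q ^ 2) N * qpoch (q ^ 2 / y) (q ^ 2) N))
       * (\<Sum>j\<le>N. (qpoch (x / q) (q ^ 2) j * qpoch (y / q) (q ^ 2) j * qpoch (inverse (q * q ^ n)) (q ^ 2) j * qpoch (q ^ 3 / (c * d)) (q ^ 2) j)
            / (qpoch (q ^ 2) (q ^ 2) j * qpoch (x * y / (q ^ 2 * q ^ n)) (q ^ 2) j * qpoch (q ^ 2 / c) (q ^ 2) j * qpoch (q ^ 2 / d) (q ^ 2) j)
             * q ^ (2 * j))"
proof -
  have pN: "(q ^ 2) ^ N = q * q ^ n" by (simp only: N power_Suc flip: power_mult)
  have e: "inverse q * q ^ 2 / (u / q) = q ^ 2 / u" for u
    using nz(1) by (simp add: power2_eq_square field_simps)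
  have e2: "inverse q * q ^ 2 / (u / q * (v / q)) = q ^ 3 / (u * v)" for u v
    using nz(1) by (simp add: power2_eq_square power3_eq_cube field_simps)
  have e3: "inverse q * (q ^ 2) ^ Suc N = q ^ n * q ^ 2" "inverse q * q ^ 2 = q"
    unfolding power_Suc pN using nz(1) by (simp_all add: power2_eq_square)
  have e4: "x / q * (y / q) / (inverse q * (q ^ 2) ^ N) = x * y / (q ^ 2 * q ^ n)"
    unfolding pN using nz(1) by (simp add: power2_eq_square field_simps)
  have e5: "q ^ 3 / (c * d) * (q ^ n * q ^ 2 / (x / q * (y / q))) = q ^ n * q ^ 7 / (x * y * c * d)"
    using nz by (simp add: divide_simps eval_nat_numeral)
  have A: "inverse q * (q ^ 2) ^ i = q ^ (2 * i - 1)" if "0 < i" for i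
    using that nz(1) by (cases i) (simp_all add: power2_eq_square power_mult)
  have A': "inverse q * (q ^ 2) ^ i = u / q \<longleftrightarrow> u = q ^ (2 * i)" for i u
    unfolding power_mult[of q 2 i] using nz(1) by (auto simp: field_simps)
  have "(\<Sum>k\<le>N. (1 - inverse q * ((q ^ 2) ^ k)\<^sup>2) * 
             (qpoch (inverse q) (q ^ 2) k * qpoch (c / q) (q ^ 2) k * qpoch (d / q) (q ^ 2) k * qpoch (x / q) (q ^ 2) k * qpoch (y / q) (q ^ 2) k * qpoch (inverse ((q ^ 2) ^ N)) (q ^ 2) k)
              / (qpoch (q ^ 2) (q ^ 2) k * qpoch (inverse q * q ^ 2 / (c / q)) (q ^ 2) k * qpoch (inverse q * q ^ 2 / (d / q)) (q ^ 2) k * qpoch (inverse q * q ^ 2 / (x / q)) (q ^ 2) k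
                  * qpoch (inverse q * q ^ 2 / (y / q)) (q ^ 2) k * qpoch (inverse q * (q ^ 2) ^ Suc N) (q ^ 2) k)
              * (inverse q * q ^ 2 / (c / q * (d / q)) * (inverse q * (q ^ 2) ^ Suc N / (x / q * (y / q)))) ^ k)
       = (1 - inverse q) * (qpoch (inverse q * q ^ 2) (q ^ 2) N * qpoch (inverse q * q ^ 2 / (x / q * (y / q))) (q ^ 2) N / (qpoch (inverse q * q ^ 2 / (x / q)) (q ^ 2) N * qpoch (inverse q * q ^ 2 / (y / q)) (q ^ 2) N))
         * (\<Sum>j\<le>N. qpoch (inverse q * q ^ 2 / (c / q * (d / q))) (q ^ 2) j * qpoch (x / q) (q ^ 2) j * qpoch (y / q) (q ^ 2) j * qpoch (inverse ((q ^ 2) ^ N)) (q ^ 2) j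
               / (qpoch (q ^ 2) (q ^ 2) j * qpoch (inverse q * q ^ 2 / (c / q)) (q ^ 2) j * qpoch (inverse q * q ^ 2 / (d / q)) (q ^ 2) j * qpoch (x / q * (y / q) / (inverse q * (q ^ 2) ^ N)) (q ^ 2) j) * (q ^ 2) ^ j)"
    (is "?L = ?R")
  proof (rule watson_transformation)
    fix i :: nat assume i: "0 < i"
    show "(q ^ 2) ^ i \<noteq> 1" using q1[of "2 * i"] i by (simp add: power_mult)
    show "inverse q * (q ^ 2) ^ i \<noteq> 1" using q1[of "2 * i - 1"] i by (simp add: A)
    show "inverse q * (q ^ 2) ^ i \<noteq> c / q" "inverse q * (q ^ 2) ^ i \<noteq> d / q" 
         "inverse q * (q ^ 2) ^ i \<noteq> x / q" "inverse q * (q ^ 2) ^ i \<noteq> y / q"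
      unfolding A' using cq dq xq yq by auto
    have "inverse q * (q ^ 2) ^ i = x / q * (y / q) \<longleftrightarrow> x * y = q ^ (2 * i + 1)"
      unfolding power_add power_mult[of q 2 i] power_one_right using nz(1) by (auto simp: field_simps)
    thus "inverse q * (q ^ 2) ^ i \<noteq> x / q * (y / q)" using xyq by auto
  qed (use nz in auto)
  hence "?L / (1 - q) = ?R / (1 - q)" by simp
  thus ?thesis
    unfolding e e2 e4 unfolding e3 unfolding e5 sum_divide_distrib qint_def powi_4k_minus_1[OF nz(1)] pN power_mult
    by (simp add: mult_ac)
qed

text \<open>Both sides are (1/q; q^2)_(N+1), split at the first or at the last factor. The factor 1
  - q^n is the source of [n].\<close>

lemma qpoch_q_div: "q \<noteq> 0 \<Longrightarrow> 2 * N = Suc n \<Longrightarrow> (1 - inverse q) * qpoch q (q ^ 2) N = qpoch (inverse q) (q ^ 2) N * (1 - q ^ n)"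
  for q :: "'a::field"
proof -
  assume q: "q \<noteq> 0" and N: "2 * N = Suc n"
  have "inverse q * q ^ 2 = q" using q by (simp add: power2_eq_square)
  moreover have "inverse q * (q ^ 2) ^ N = q ^ n" using q N by (simp flip: power_mult)
  ultimately show ?thesis using qpoch_Suc[of "inverse q" "q ^ 2" N] qpoch_Suc'[of "inverse q" "q ^ 2" N] by simp
qed

text \<open>Complete reversal of (q^(2-n); q^2)_N and (b q^(3-n); q^2)_N gives (1/q; q^2)_N and
  (1/(q^2 b); q^2)_N. Signs and powers cancel except for (bq)^N, as bq is the ratio of the two
  arguments.\<close>

lemma watson_prefactor_a:
  fixes q b :: "'a::field"
  assumes N: "2 * N = Suc n" and nz: "q \<noteq> 0" "b \<noteq> 0" and q1: "\<And>i. 0 < i \<Longrightarrow> q ^ i \<noteq> 1"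
  shows "(1 - inverse q) / (1 - q) * (qpoch q (q ^ 2) N * qpoch (q ^ 3 / (q ^ n * inverse b)) (q ^ 2) N 
          / (qpoch (q ^ 2 / q ^ n) (q ^ 2) N * qpoch (q ^ 2 / inverse b) (q ^ 2) N))
    = qint q (int n) * ((b * q) ^ N * qpoch (inverse (q ^ 2 * b)) (q ^ 2) N / qpoch (b * q ^ 2) (q ^ 2) N)"
proof -
  define \<tau> where "\<tau> = (\<Prod>l<N. - inverse ((q ^ 2) ^ Suc l))"
  have \<tau>: "\<tau> \<noteq> 0" using nz by (simp add: \<tau>_def)
  have pN: "(q ^ 2) ^ N = q * q ^ n" by (simp only: N power_Suc flip: power_mult)
  define g where "g = q ^ 2 / q ^ n"
  have g: "g \<noteq> 0" using nz by (simp add: g_def)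
  have g1: "q ^ 3 / (q ^ n * inverse b) = b * q * g" 
    using nz by (simp add: g_def power2_eq_square power3_eq_cube field_simps)
  have "q ^ 2 / (g * (q * q ^ n)) = inverse q"
    using nz by (simp add: g_def power2_eq_square field_simps)
  hence r1: "\<tau> * (g * (q * q ^ n)) ^ N * qpoch (inverse q) (q ^ 2) N = qpoch g (q ^ 2) N"
    using qpoch_reverse_suffix[of "q ^ 2" g N N] nz g unfolding \<tau>_def pN by simp
  have "q ^ 2 / (b * q * g * (q * q ^ n)) = inverse (q ^ 2 * b)"
    using nz by (simp add: g_def power2_eq_square field_simps)
  hence r2: "\<tau> * (b * q * g * (q * q ^ n)) ^ N * qpoch (inverse (q ^ 2 * b)) (q ^ 2) N = qpoch (b * q * g) (q ^ 2) N"
    using qpoch_reverse_suffix[of "q ^ 2" "b * q * g" N N] nz g unfolding \<tau>_def pN by simp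
  \<comment> \<open>This product is cancelled below; its factors are 1 - q^m with m odd.\<close>
  have nz2: "qpoch (inverse q) (q ^ 2) N \<noteq> 0"
  proof -
    have "inverse q * (q ^ 2) ^ j \<noteq> 1" for j
    proof (cases j)
      case (Suc m)
      have "inverse q * (q ^ 2) ^ Suc m = q * (q ^ 2) ^ m" using nz by (simp add: power2_eq_square)
      also have "\<dots> = q ^ Suc (2 * m)" by (simp add: power_mult)
      finally show ?thesis using q1[of "Suc (2 * m)"] Suc by simp
    qed (use q1[of 1] in simp)
    thus ?thesis by (auto simp: qpoch_eq_0_iff)
  qed
  have G: "(g * (q * q ^ n)) ^ N \<noteq> 0" using g nz by simp
  have sp: "(b * q * g * (q * q ^ n)) ^ N = (b * q) ^ N * (g * (q * q ^ n)) ^ N"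
    by (simp add: mult.assoc flip: power_mult_distrib)
  have "(1 - inverse q) / (1 - q) * (qpoch q (q ^ 2) N * qpoch (q ^ 3 / (q ^ n * inverse b)) (q ^ 2) N 
          / (qpoch (q ^ 2 / q ^ n) (q ^ 2) N * qpoch (q ^ 2 / inverse b) (q ^ 2) N))
     = ((1 - inverse q) * qpoch q (q ^ 2) N) / (1 - q) * (\<tau> * ((b * q) ^ N * (g * (q * q ^ n)) ^ N) * qpoch (inverse (q ^ 2 * b)) (q ^ 2) N)
        / ((\<tau> * (g * (q * q ^ n)) ^ N * qpoch (inverse q) (q ^ 2) N) * qpoch (b * q ^ 2) (q ^ 2) N)"
    unfolding g1 r1 r2[symmetric] sp g_def[symmetric] by (simp add: mult_ac divide_inverse)
  also have "\<dots> = (1 - q ^ n) / (1 - q) * ((b * q) ^ N * qpoch (inverse (q ^ 2 * b)) (q ^ 2) N / qpoch (b * q ^ 2) (q ^ 2) N)"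
    unfolding qpoch_q_div[OF nz(1) N] using \<tau> G nz2 g nz by simp
  finally show ?thesis by (simp add: qint_def)
qed

text \<open>Since x y = 1, the numerator is (q; q^2)_N (q^3; q^2)_N, and both reduce to (1/q; q^2)_N
  by exchanging end factors. The two factorials of length 2 in Theta are made of exactly these end
  factors.\<close>

lemma watson_prefactor_b:
  fixes q a :: "'a::field"
  assumes N: "2 * N = Suc n" and nz: "q \<noteq> 0" "a \<noteq> 0" and q1: "\<And>i. 0 < i \<Longrightarrow> q ^ i \<noteq> 1"
  shows "(1 - inverse q) / (1 - q) * (qpoch q (q ^ 2) N * qpoch (q ^ 3 / (a * inverse a)) (q ^ 2) N 
          / (qpoch (q ^ 2 / a) (q ^ 2) N * qpoch (q ^ 2 / inverse a) (q ^ 2) N))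
    = qint q (int n) * (qpoch (q ^ n) (q ^ 2) 2 * (qpoch (inverse q) (q ^ 2) N) ^ 2
          / (qpoch (inverse q) (q ^ 2) 2 * qpoch (q ^ 2 / a) (q ^ 2) N
             * qpoch (a * q ^ 2) (q ^ 2) N))"
proof -
  have q: "1 - q \<noteq> 0" "1 - inverse q \<noteq> 0" using q1[of 1] by auto
  have pN: "(q ^ 2) ^ N = q * q ^ n" by (simp only: N power_Suc flip: power_mult)
  define r where "r = qpoch (inverse q) (q ^ 2) N"
  have 1: "qpoch q (q ^ 2) N = r * (1 - q ^ n) / (1 - inverse q)"
    using qpoch_q_div[OF nz(1) N] q by (simp add: r_def field_simps)
  have "(1 - q) * qpoch (q ^ 3) (q ^ 2) N = qpoch q (q ^ 2) N * (1 - q ^ n * q ^ 2)"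
    using qpoch_Suc[of q "q ^ 2" N] qpoch_Suc'[of q "q ^ 2" N] pN
    by (simp add: power2_eq_square power3_eq_cube mult_ac)
  hence 2: "qpoch (q ^ 3) (q ^ 2) N = r * (1 - q ^ n) / (1 - inverse q) * (1 - q ^ n * q ^ 2) / (1 - q)"
    using q unfolding 1 by (simp add: eq_divide_eq mult_ac)
  have 3: "qpoch (q ^ n) (q ^ 2) 2 = (1 - q ^ n) * (1 - q ^ n * q ^ 2)"
     "qpoch (inverse q) (q ^ 2) 2 = (1 - inverse q) * (1 - q)"
    using nz by (simp_all add: qpoch_def numeral_2_eq_2 power2_eq_square)
  have 4: "q ^ 3 / (a * inverse a) = q ^ 3" "q ^ 2 / inverse a = a * q ^ 2" using nz by (simp_all add: mult.commute divide_inverse)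
  show ?thesis unfolding 4 1 2 3 r_def[symmetric] qint_def
    using q by (simp add: power2_eq_square mult_ac)
qed

text \<open>Depending on the case, a/q, 1/(qa) or 1/(qb) becomes q^(-n-1) = (q^2)^(-N).\<close>

lemma lhs_term_eq_0:
  fixes q a b c d :: "'a::field"
  assumes N: "2 * N = Suc n" "q \<noteq> 0" "N < k" "a = q ^ n \<or> a = inverse (q ^ n) \<or> b = q ^ n"
  shows "lhs_term q a b c d k = 0"
proof -
  have pN: "(q ^ 2) ^ N = q * q ^ n" by (simp only: N power_Suc flip: power_mult)
  have "qpoch (inverse (q * q ^ n)) (q ^ 2) k = 0"
    using qpoch_inverse_power_eq_0[of "q ^ 2" N k] assms by (simp add: pN)
  moreover have "inverse (q ^ n) / q = inverse (q * q ^ n)" by (simp add: divide_inverse)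
  ultimately show ?thesis using assms(4) by (auto simp: lhs_term_def)
qed

lemma sum_lhs_term_truncate:
  fixes q a b c d :: "'a::field"
  assumes N: "2 * N = Suc n" "q \<noteq> 0" "N \<le> M" "a = q ^ n \<or> a = inverse (q ^ n) \<or> b = q ^ n"
  shows "(\<Sum>k=0..M. lhs_term q a b c d k) = (\<Sum>k\<le>N. lhs_term q a b c d k)"
  using lhs_term_eq_0[OF assms(1,2) _ assms(4)] assms(3)
  by (intro sum.mono_neutral_right) auto

lemma theta_at_a:
  fixes q a b :: "'a::field"
  assumes N: "2 * N = Suc n" and q: "q \<noteq> 0" and a: "a = q ^ n \<or> a = inverse (q ^ n)" and ab: "a \<noteq> b" "a * b \<noteq> 1"
  shows "Theta q a b n = (b * q) ^ N * qpoch (inverse (q ^ 2 * b)) (q ^ 2) N / qpoch (b * q ^ 2) (q ^ 2) N"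
proof -
  have n: "(n + 1) div 2 = N" using N by simp
  \<comment> \<open>The identity for the coefficients of Theta, with (1 - a q^n)(a - q^n) = 0
    inserted.\<close>
  have "(b - q ^ n) * (a * b - 1 - a ^ 2 + a * q ^ n) = (a - b) * (1 - a * b)"
    using a
  proof
    assume "a = inverse (q ^ n)"
    hence aq: "a * q ^ n = 1" using q by simp
    have "(b - q ^ n) * (a * b - 1 - a ^ 2 + a * q ^ n) = (a * b - a * q ^ n) * (b - a)"
      unfolding aq by (simp add: algebra_simps power2_eq_square) (simp add: aq flip: mult.assoc)
    thus ?thesis unfolding aq by (simp add: algebra_simps)
  qed (simp add: algebra_simps power2_eq_square)
  hence 1: "(b - q ^ n) * (a * b - 1 - a ^ 2 + a * q ^ n) / ((a - b) * (1 - a * b)) = 1" using ab by auto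
  have "(1 - a * q ^ n) * (a - q ^ n) = 0" using a q by auto
  thus ?thesis unfolding Theta_def n 1 by simp
qed

lemma theta_at_b:
  fixes q a b :: "'a::field"
  assumes N: "2 * N = Suc n" and b: "b = q ^ n" and ab: "a \<noteq> b" "a * b \<noteq> 1"
  shows "Theta q a b n = qpoch (q ^ n) (q ^ 2) 2 * (qpoch (inverse q) (q ^ 2) N) ^ 2
          / (qpoch (inverse q) (q ^ 2) 2 * qpoch (q ^ 2 / a) (q ^ 2) N * qpoch (a * q ^ 2) (q ^ 2) N)"
proof -
  have n: "(n + 1) div 2 = N" using N by simp
  have "(1 - a * q ^ n) * (a - q ^ n) / ((a - b) * (1 - a * b)) = 1" using ab b by (auto simp: mult.commute)
  thus ?thesis unfolding Theta_def n using b by simp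
qed

text \<open>The summands are symmetric in a and 1/a, so both values of a give the same series, with
  x = q^n and y = 1/b.\<close>

lemma transformation_at_a:
  fixes q a b c d :: "'a::field"
  assumes N: "2 * N = Suc n" "N \<le> M" and nz: "q \<noteq> 0" "b \<noteq> 0" "c \<noteq> 0" "d \<noteq> 0"
    and a: "a = q ^ n \<or> a = inverse (q ^ n)" and ab: "a \<noteq> b" "a * b \<noteq> 1"
    and q1: "\<And>i. 0 < i \<Longrightarrow> q ^ i \<noteq> 1" and qn: "\<And>i. q ^ n \<noteq> q ^ (2 * i)" and bq: "\<And>i. b * q ^ i \<noteq> 1"
    and cq: "\<And>i. c \<noteq> q ^ (2 * i)" and dq: "\<And>i. d \<noteq> q ^ (2 * i)" and bqn: "\<And>i. b * q ^ i \<noteq> q ^ n"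
  shows "(\<Sum>k=0..M. lhs_term q a b c d k) = qint q (int n) * Theta q a b n * (\<Sum>k=0..N. rhs_term q a b c d k)"
proof -
  have "(\<Sum>k=0..M. lhs_term q a b c d k) = (\<Sum>k\<le>N. lhs_term q a b c d k)"
    using N nz a by (intro sum_lhs_term_truncate) auto
  also have "\<dots> = (\<Sum>k\<le>N. qint q (4 * int k - 1) * (qpoch (q ^ n / q) (q ^ 2) k * qpoch (inverse b / q) (q ^ 2) k 
            * qpoch (inverse (q * q ^ n)) (q ^ 2) k * qpoch (c / q) (q ^ 2) k * qpoch (d / q) (q ^ 2) k * qpoch (inverse q) (q ^ 2) k)
         / (qpoch (q ^ 2 / q ^ n) (q ^ 2) k * qpoch (q ^ 2 / inverse b) (q ^ 2) k * qpoch (q ^ n * q ^ 2) (q ^ 2) k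
            * qpoch (q ^ 2 / c) (q ^ 2) k * qpoch (q ^ 2 / d) (q ^ 2) k * qpoch (q ^ 2) (q ^ 2) k)
         * (q ^ n * q ^ 7 / (q ^ n * inverse b * c * d)) ^ k)"
  proof (rule sum.cong[OF refl])
    fix k
    have 1: "inverse (q * b) = inverse b / q" "q ^ 2 / inverse b = b * q ^ 2" "inverse (q ^ n) / q = inverse (q * q ^ n)"
        "q ^ 2 / inverse (q ^ n) = q ^ n * q ^ 2" "inverse (q ^ n) * q ^ 2 = q ^ 2 / q ^ n" "inverse (q * inverse (q ^ n)) = q ^ n / q"
        "q ^ n * q ^ 7 / (q ^ n * inverse b * c * d) = b * q ^ 7 / (c * d)"
      using nz by (simp_all add: field_simps)
    show "lhs_term q a b c d k = qint q (4 * int k - 1) * (qpoch (q ^ n / q) (q ^ 2) k * qpoch (inverse b / q) (q ^ 2) k 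
            * qpoch (inverse (q * q ^ n)) (q ^ 2) k * qpoch (c / q) (q ^ 2) k * qpoch (d / q) (q ^ 2) k * qpoch (inverse q) (q ^ 2) k)
         / (qpoch (q ^ 2 / q ^ n) (q ^ 2) k * qpoch (q ^ 2 / inverse b) (q ^ 2) k * qpoch (q ^ n * q ^ 2) (q ^ 2) k
            * qpoch (q ^ 2 / c) (q ^ 2) k * qpoch (q ^ 2 / d) (q ^ 2) k * qpoch (q ^ 2) (q ^ 2) k)
         * (q ^ n * q ^ 7 / (q ^ n * inverse b * c * d)) ^ k"
      using a
    proof
      assume a: "a = q ^ n"
      show ?thesis unfolding lhs_term_def a unfolding 1 by (simp only: mult_ac)
    next
      assume a: "a = inverse (q ^ n)"
      show ?thesis unfolding lhs_term_def a unfolding 1 by (simp only: mult_ac)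
    qed
  qed
  also have "\<dots> = (1 - inverse q) / (1 - q) * (qpoch q (q ^ 2) N * qpoch (q ^ 3 / (q ^ n * inverse b)) (q ^ 2) N 
          / (qpoch (q ^ 2 / q ^ n) (q ^ 2) N * qpoch (q ^ 2 / inverse b) (q ^ 2) N))
       * (\<Sum>j\<le>N. (qpoch (q ^ n / q) (q ^ 2) j * qpoch (inverse b / q) (q ^ 2) j * qpoch (inverse (q * q ^ n)) (q ^ 2) j * qpoch (q ^ 3 / (c * d)) (q ^ 2) j)
            / (qpoch (q ^ 2) (q ^ 2) j * qpoch (q ^ n * inverse b / (q ^ 2 * q ^ n)) (q ^ 2) j * qpoch (q ^ 2 / c) (q ^ 2) j * qpoch (q ^ 2 / d) (q ^ 2) j)
             * q ^ (2 * j))"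
  proof (rule watson_specialised)
    show "inverse b \<noteq> q ^ (2 * i)" for i using bq[of "2 * i"] nz by (auto simp: field_simps)
    show "q ^ n * inverse b \<noteq> q ^ (2 * i + 1)" for i
      using bqn[of "2 * i + 1"] nz by (auto simp: field_simps)
  qed (use N nz q1 qn cq dq in auto)
  also have "(\<Sum>j\<le>N. (qpoch (q ^ n / q) (q ^ 2) j * qpoch (inverse b / q) (q ^ 2) j * qpoch (inverse (q * q ^ n)) (q ^ 2) j * qpoch (q ^ 3 / (c * d)) (q ^ 2) j)
            / (qpoch (q ^ 2) (q ^ 2) j * qpoch (q ^ n * inverse b / (q ^ 2 * q ^ n)) (q ^ 2) j * qpoch (q ^ 2 / c) (q ^ 2) j * qpoch (q ^ 2 / d) (q ^ 2) j)
             * q ^ (2 * j)) = (\<Sum>k\<le>N. rhs_term q a b c d k)"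
  proof (rule sum.cong[OF refl])
    fix j
    have 1: "inverse (q * b) = inverse b / q" "inverse (q ^ n) / q = inverse (q * q ^ n)"
        "inverse (q * inverse (q ^ n)) = q ^ n / q" "q ^ n * inverse b / (q ^ 2 * q ^ n) = inverse (q ^ 2 * b)"
      using nz by (simp_all add: field_simps)
    show "(qpoch (q ^ n / q) (q ^ 2) j * qpoch (inverse b / q) (q ^ 2) j * qpoch (inverse (q * q ^ n)) (q ^ 2) j * qpoch (q ^ 3 / (c * d)) (q ^ 2) j)
            / (qpoch (q ^ 2) (q ^ 2) j * qpoch (q ^ n * inverse b / (q ^ 2 * q ^ n)) (q ^ 2) j * qpoch (q ^ 2 / c) (q ^ 2) j * qpoch (q ^ 2 / d) (q ^ 2) j)
             * q ^ (2 * j) = rhs_term q a b c d j"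
      using a
    proof
      assume a: "a = q ^ n"
      show ?thesis unfolding rhs_term_def a unfolding 1 by (simp only: mult_ac)
    next
      assume a: "a = inverse (q ^ n)"
      show ?thesis unfolding rhs_term_def a unfolding 1 by (simp only: mult_ac)
    qed
  qed
  also note watson_prefactor_a[OF N(1) nz(1,2) q1]
  finally show ?thesis unfolding theta_at_a[OF N(1) nz(1) a ab] atLeast0AtMost .
qed

text \<open>Now 1/(qb) terminates the series, and x = a, y = 1/a.\<close>

lemma transformation_at_b:
  fixes q a b c d :: "'a::field"
  assumes N: "2 * N = Suc n" "N \<le> M" and nz: "q \<noteq> 0" "a \<noteq> 0" "c \<noteq> 0" "d \<noteq> 0"
    and b: "b = q ^ n" and ab: "a \<noteq> b" "a * b \<noteq> 1"
    and q1: "\<And>i. 0 < i \<Longrightarrow> q ^ i \<noteq> 1" and aq: "\<And>i. a \<noteq> q ^ (2 * i)" "\<And>i. a * q ^ i \<noteq> 1"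
    and cq: "\<And>i. c \<noteq> q ^ (2 * i)" and dq: "\<And>i. d \<noteq> q ^ (2 * i)"
  shows "(\<Sum>k=0..M. lhs_term q a b c d k) = qint q (int n) * Theta q a b n * (\<Sum>k=0..N. rhs_term q a b c d k)"
proof -
  have "(\<Sum>k=0..M. lhs_term q a b c d k) = (\<Sum>k\<le>N. lhs_term q a b c d k)"
    using N nz b by (intro sum_lhs_term_truncate) auto
  also have "\<dots> = (\<Sum>k\<le>N. qint q (4 * int k - 1) * (qpoch (a / q) (q ^ 2) k * qpoch (inverse a / q) (q ^ 2) k 
            * qpoch (inverse (q * q ^ n)) (q ^ 2) k * qpoch (c / q) (q ^ 2) k * qpoch (d / q) (q ^ 2) k * qpoch (inverse q) (q ^ 2) k)
         / (qpoch (q ^ 2 / a) (q ^ 2) k * qpoch (q ^ 2 / inverse a) (q ^ 2) k * qpoch (q ^ n * q ^ 2) (q ^ 2) k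
            * qpoch (q ^ 2 / c) (q ^ 2) k * qpoch (q ^ 2 / d) (q ^ 2) k * qpoch (q ^ 2) (q ^ 2) k)
         * (q ^ n * q ^ 7 / (a * inverse a * c * d)) ^ k)"
  proof (rule sum.cong[OF refl])
    fix k
    have 1: "inverse (q * a) = inverse a / q" "q ^ 2 / inverse a = a * q ^ 2" "a * inverse a * c * d = c * d"
      using nz by (simp_all add: field_simps)
    show "lhs_term q a b c d k = qint q (4 * int k - 1) * (qpoch (a / q) (q ^ 2) k * qpoch (inverse a / q) (q ^ 2) k 
            * qpoch (inverse (q * q ^ n)) (q ^ 2) k * qpoch (c / q) (q ^ 2) k * qpoch (d / q) (q ^ 2) k * qpoch (inverse q) (q ^ 2) k)
         / (qpoch (q ^ 2 / a) (q ^ 2) k * qpoch (q ^ 2 / inverse a) (q ^ 2) k * qpoch (q ^ n * q ^ 2) (q ^ 2) k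
            * qpoch (q ^ 2 / c) (q ^ 2) k * qpoch (q ^ 2 / d) (q ^ 2) k * qpoch (q ^ 2) (q ^ 2) k)
         * (q ^ n * q ^ 7 / (a * inverse a * c * d)) ^ k"
      unfolding lhs_term_def b 1 ..
  qed
  also have "\<dots> = (1 - inverse q) / (1 - q) * (qpoch q (q ^ 2) N * qpoch (q ^ 3 / (a * inverse a)) (q ^ 2) N 
          / (qpoch (q ^ 2 / a) (q ^ 2) N * qpoch (q ^ 2 / inverse a) (q ^ 2) N))
       * (\<Sum>j\<le>N. (qpoch (a / q) (q ^ 2) j * qpoch (inverse a / q) (q ^ 2) j * qpoch (inverse (q * q ^ n)) (q ^ 2) j * qpoch (q ^ 3 / (c * d)) (q ^ 2) j)
            / (qpoch (q ^ 2) (q ^ 2) j * qpoch (a * inverse a / (q ^ 2 * q ^ n)) (q ^ 2) j * qpoch (q ^ 2 / c) (q ^ 2) j * qpoch (q ^ 2 / d) (q ^ 2) j)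
             * q ^ (2 * j))"
  proof (rule watson_specialised)
    show "inverse a \<noteq> q ^ (2 * i)" for i using aq(2)[of "2 * i"] nz by (auto simp: field_simps)
    show "a * inverse a \<noteq> q ^ (2 * i + 1)" for i using q1[of "2 * i + 1"] nz by auto
  qed (use N nz q1 aq(1) cq dq in auto)
  also have "(\<Sum>j\<le>N. (qpoch (a / q) (q ^ 2) j * qpoch (inverse a / q) (q ^ 2) j * qpoch (inverse (q * q ^ n)) (q ^ 2) j * qpoch (q ^ 3 / (c * d)) (q ^ 2) j)
            / (qpoch (q ^ 2) (q ^ 2) j * qpoch (a * inverse a / (q ^ 2 * q ^ n)) (q ^ 2) j * qpoch (q ^ 2 / c) (q ^ 2) j * qpoch (q ^ 2 / d) (q ^ 2) j)
             * q ^ (2 * j)) = (\<Sum>k\<le>N. rhs_term q a b c d k)"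
  proof (rule sum.cong[OF refl])
    fix j
    have 1: "inverse (q * a) = inverse a / q" "a * inverse a / (q ^ 2 * q ^ n) = inverse (q ^ 2 * q ^ n)"
      using nz by (simp_all add: field_simps)
    show "(qpoch (a / q) (q ^ 2) j * qpoch (inverse a / q) (q ^ 2) j * qpoch (inverse (q * q ^ n)) (q ^ 2) j * qpoch (q ^ 3 / (c * d)) (q ^ 2) j)
            / (qpoch (q ^ 2) (q ^ 2) j * qpoch (a * inverse a / (q ^ 2 * q ^ n)) (q ^ 2) j * qpoch (q ^ 2 / c) (q ^ 2) j * qpoch (q ^ 2 / d) (q ^ 2) j)
             * q ^ (2 * j) = rhs_term q a b c d j"
      unfolding rhs_term_def b 1 ..
  qed
  also note watson_prefactor_b[OF N(1) nz(1,2) q1]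
  finally show ?thesis unfolding theta_at_b[OF N(1) b ab] atLeast0AtMost .
qed

section \<open>From specialised identities to congruences\<close>

lemma Fract_power: "Fract X 1 ^ k = Fract (X ^ k) (1 :: 'a::idom)"
  by (induction k) (simp_all add: One_fract_def)

lemma unit_at_power_int: "unit_at P x \<Longrightarrow> unit_at P (x powi m)"
  by (simp add: power_int_def unit_at_power unit_at_inverse)

lemma cong_at_of_dvd: "P dvd X - Y \<Longrightarrow> cong_at P (Fract X 1) (Fract Y 1)"
proof (elim dvdE)
  fix Z assume "X - Y = P * Z"
  thus ?thesis unfolding cong_at_def by (intro conjI exI[of _ "Fract Z 1"]) simp_all
qed

context good_modulus
begin

lemma unit_of_coprime: "coprime X P \<Longrightarrow> unit_at P (Fract X 1)"
  using not_unit by (intro unit_at_Fract) auto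

lemma unit_vars: "unit_at P vq" "unit_at P va" "unit_at P vb" "unit_at P vc" "unit_at P vd"
  unfolding vq_def va_def vb_def vc_def vd_def
  using coprime_q coprime_a coprime_b coprime_c coprime_d by (auto intro: unit_of_coprime)

lemmas nonzero_vars = unit_vars[THEN unit_at_nonzero]

lemma unit_1_minus_q: "unit_at P (1 - vq)"
  using unit_of_coprime[OF coprime_1q] by (simp add: vq_def One_fract_def)

lemma unit_a_minus_b: "unit_at P (va - vb)"
  using unit_of_coprime[OF coprime_a_b] by (simp add: va_def vb_def)

lemma unit_1_minus_ab: "unit_at P (1 - va * vb)"
  using unit_of_coprime[OF coprime_1_ab] by (simp add: va_def vb_def One_fract_def)

lemma unit_quotient_factor:
  assumes "unit_at P x" "unit_at P (x - vq ^ (2 * Suc j))"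
  shows "unit_at P (1 - vq ^ 2 / x * (vq ^ 2) ^ j)"
proof -
  have "1 - vq ^ 2 / x * (vq ^ 2) ^ j = (x - vq ^ (2 * Suc j)) / x"
    using unit_at_nonzero[OF assms(1)] by (simp add: diff_divide_distrib power_mult power2_eq_square)
  thus ?thesis using assms by (simp add: unit_at_divide)
qed

lemma unit_product_factor:
  assumes "unit_at P (1 - x * vq ^ (2 * Suc j))"
  shows "unit_at P (1 - x * vq ^ 2 * (vq ^ 2) ^ j)"
  using assms by (simp add: power_mult power2_eq_square mult.assoc)

lemma unit_factors:
  "unit_at P (1 - vq ^ 2 / va * (vq ^ 2) ^ j)" "unit_at P (1 - va * vq ^ 2 * (vq ^ 2) ^ j)"
  "unit_at P (1 - vb * vq ^ 2 * (vq ^ 2) ^ j)" "unit_at P (1 - vq ^ 2 / vc * (vq ^ 2) ^ j)"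
  "unit_at P (1 - vq ^ 2 / vd * (vq ^ 2) ^ j)"
  subgoal by (rule unit_quotient_factor[OF unit_vars(2)], use unit_of_coprime[OF coprime_a_q[of "Suc j"]] in \<open>simp add: va_def vq_def Fract_power del: power_Suc mult_Suc_right\<close>)
  subgoal by (rule unit_product_factor, use unit_of_coprime[OF coprime_1_aq[of "Suc j"]] in \<open>simp add: va_def vq_def Fract_power One_fract_def del: power_Suc mult_Suc_right\<close>)
  subgoal by (rule unit_product_factor, use unit_of_coprime[OF coprime_1_bq[of "Suc j"]] in \<open>simp add: vb_def vq_def Fract_power One_fract_def del: power_Suc mult_Suc_right\<close>)
  subgoal by (rule unit_quotient_factor[OF unit_vars(4)], use unit_of_coprime[OF coprime_c_q[of "Suc j"]] in \<open>simp add: vc_def vq_def Fract_power del: power_Suc mult_Suc_right\<close>)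
  subgoal by (rule unit_quotient_factor[OF unit_vars(5)], use unit_of_coprime[OF coprime_d_q[of "Suc j"]] in \<open>simp add: vd_def vq_def Fract_power del: power_Suc mult_Suc_right\<close>)
  done

lemma unit_factor_q: "Suc j < n \<Longrightarrow> unit_at P (1 - vq ^ 2 * (vq ^ 2) ^ j)"
  using unit_product_factor[of 1 j] unit_of_coprime[OF coprime_1_q[of "Suc j"]]
  by (simp add: vq_def Fract_power One_fract_def del: power_Suc mult_Suc_right)

text \<open>Multiplication by q^2 b gives b q^2 - q^(2j); the index j = 0 occurs because the
  parameter is q^(-2)/b.\<close>

lemma unit_factor_b: "unit_at P (1 - inverse (vq ^ 2 * vb) * (vq ^ 2) ^ j)"
proof -
  have "1 - inverse (vq ^ 2 * vb) * (vq ^ 2) ^ j = (vb * vq ^ 2 - vq ^ (2 * j)) / (vq ^ 2 * vb)"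
    unfolding power_mult[of vq 2] using nonzero_vars by (simp add: field_simps)
  moreover have "unit_at P (vb * vq ^ 2 - vq ^ (2 * j))"
    using unit_of_coprime[OF coprime_bq_q[of j]] by (simp add: vb_def vq_def Fract_power)
  ultimately show ?thesis by (simp add: unit_at_divide unit_at_mult unit_at_power unit_vars)
qed

text \<open>The only denominator built on 1/q is (1/q; q^2)_2 in Theta.\<close>

lemma unit_factor_inverse_q: "j < 2 \<Longrightarrow> unit_at P (1 - inverse vq * (vq ^ 2) ^ j)"
proof -
  assume "j < 2"
  then consider "j = 0" | "j = 1" by linarith
  thus ?thesis
  proof cases
    case 1
    have "1 - inverse vq = - (1 - vq) / vq" using nonzero_vars by (simp add: field_simps)
    thus ?thesis using 1 unit_at_divide[OF unit_at_uminus[OF unit_1_minus_q] unit_vars(1)] by simp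
  next
    case 2
    have "inverse vq * vq ^ 2 = vq" using nonzero_vars by (simp add: power2_eq_square)
    thus ?thesis using 2 unit_1_minus_q by simp
  qed
qed

lemmas integral_vars = unit_vars[THEN unit_at_imp_integral]

lemmas cong_intros = cong_at_divide[OF not_unit] cong_at_inverse[OF not_unit] cong_at_mult cong_at_add cong_at_diff 
  cong_at_power cong_at_qpoch cong_at_refl integral_at_power integral_vars integral_at_1
  unit_at_mult unit_at_power unit_at_qpoch unit_vars

lemma cong_qint: "cong_at P (qint vq m) (qint vq m)"
  unfolding qint_def
  by (intro cong_intros unit_1_minus_q unit_at_imp_integral[OF unit_at_power_int])

text \<open>The bound k < n keeps (q^2; q^2)_k a unit, also modulo Phi_n.\<close>

lemma cong_lhs_term:
  assumes "cong_at P va a" "cong_at P vb b" "k < n"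
  shows "cong_at P (lhs_term vq va vb vc vd k) (lhs_term vq a b vc vd k)"
proof -
  have "unit_at P (1 - vq ^ 2 * (vq ^ 2) ^ j)" if "j < k" for j using that assms(3) by (intro unit_factor_q) auto
  thus ?thesis unfolding lhs_term_def
    by (intro cong_intros cong_qint assms(1,2) unit_factors)
qed

lemma cong_rhs_term:
  assumes "cong_at P va a" "cong_at P vb b" "k < n"
  shows "cong_at P (rhs_term vq va vb vc vd k) (rhs_term vq a b vc vd k)"
proof -
  have "unit_at P (1 - vq ^ 2 * (vq ^ 2) ^ j)" if "j < k" for j using that assms(3) by (intro unit_factor_q) auto
  thus ?thesis unfolding rhs_term_def
    by (intro cong_intros cong_qint assms(1,2) unit_factors unit_factor_b)
qed

lemma cong_Theta:
  assumes "cong_at P va a" "cong_at P vb b"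
  shows "cong_at P (Theta vq va vb n) (Theta vq a b n)"
  unfolding Theta_def
  by (intro cong_intros assms unit_factors unit_factor_inverse_q unit_a_minus_b unit_1_minus_ab)

text \<open>Each side is congruent to its specialisation because all denominators are units; the
  exact identity between the specialised sides joins them.\<close>

lemma cong_of_specialisation:
  assumes "cong_at P va a" "cong_at P vb b" "M < n" "N < n"
    and "(\<Sum>k=0..M. lhs_term vq a b vc vd k) = qint vq (int n) * Theta vq a b n * (\<Sum>k=0..N. rhs_term vq a b vc vd k)"
  shows "cong_at P (\<Sum>k=0..M. lhs_term vq va vb vc vd k)
     (qint vq (int n) * Theta vq va vb n * (\<Sum>k=0..N. rhs_term vq va vb vc vd k))"
proof -
  have "cong_at P (\<Sum>k=0..M. lhs_term vq va vb vc vd k) (\<Sum>k=0..M. lhs_term vq a b vc vd k)"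
    using assms by (intro cong_at_sum cong_lhs_term) auto
  moreover have "cong_at P (qint vq (int n) * Theta vq va vb n * (\<Sum>k=0..N. rhs_term vq va vb vc vd k))
     (qint vq (int n) * Theta vq a b n * (\<Sum>k=0..N. rhs_term vq a b vc vd k))"
    using assms(4) by (intro cong_at_mult cong_qint cong_Theta cong_at_sum cong_rhs_term assms(1,2)) auto
  ultimately show ?thesis unfolding assms(5) using cong_at_trans cong_at_sym by blast
qed

end

section \<open>The cyclotomic factor of the modulus\<close>

text \<open>A well-poised pair: the two parameters have product q = A p for A = 1/q, p = q^2. The
  summand contains six such pairs.\<close>

definition poised_ratio :: "'a::field \<Rightarrow> 'a \<Rightarrow> nat \<Rightarrow> 'a" where
  "poised_ratio q x k = qpoch (x / q) (q ^ 2) k / qpoch (q ^ 2 / x) (q ^ 2) k"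

lemma lhs_term_poised_ratio:
  "lhs_term q a b c d k = qint q (4 * int k - 1) * (poised_ratio q a k * poised_ratio q (inverse a) k
     * poised_ratio q (inverse b) k * poised_ratio q c k * poised_ratio q d k * poised_ratio q 1 k) * (b * q ^ 7 / (c * d)) ^ k"
proof -
  have "inverse (q * u) = inverse u / q" "q ^ 2 / inverse u = u * q ^ 2" for u
    by (simp_all add: divide_inverse mult.commute)
  thus ?thesis unfolding lhs_term_def poised_ratio_def by (simp add: inverse_eq_divide mult_ac)
qed

text \<open>Invertibility of 2 is required because the pairing of terms only shows that a sum is
  congruent to its own negative.\<close>

locale cyclotomic_modulus = good_modulus +
  fixes N :: nat
  assumes q_n: "cong_at P (vq ^ n) 1" and unit_2: "unit_at P 2" and N: "2 * N = Suc n" and n1: "1 < n"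
begin

lemma N_less: "N < n" using N n1 by simp

definition poised :: "R fract \<Rightarrow> bool" where
  "poised x \<longleftrightarrow> unit_at P x \<and> (\<forall>j<N. unit_at P (1 - vq ^ 2 / x * (vq ^ 2) ^ j))"

lemma poised_vars: "poised va" "poised (inverse va)" "poised (inverse vb)" "poised vc" "poised vd" "poised 1"
proof -
  have *: "vq ^ 2 / inverse u = u * vq ^ 2" for u by (simp add: divide_inverse mult.commute)
  have 1: "unit_at P (1 - vq ^ 2 * (vq ^ 2) ^ j)" if "j < N" for j using that N_less by (intro unit_factor_q) auto
  show "poised va" "poised (inverse va)" "poised (inverse vb)" "poised vc" "poised vd"
    unfolding poised_def * by (intro conjI allI impI unit_vars unit_factors unit_at_inverse)+
  show "poised 1" unfolding poised_def using 1 by simp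
qed

lemma poised_unit_qpoch: "poised x \<Longrightarrow> k \<le> N \<Longrightarrow> unit_at P (qpoch (vq ^ 2 / x) (vq ^ 2) k)"
  unfolding poised_def by (intro unit_at_qpoch) auto

text \<open>The product of the factors -x / q^(2j+2) over j < k, pulled out when k factors are
  reversed.\<close>

definition \<alpha> :: "R fract \<Rightarrow> nat \<Rightarrow> R fract" where
  "\<alpha> x k = (- x) ^ k / vq ^ (k * (k + 1))"

lemma \<alpha>_Suc: "\<alpha> x (Suc k) = \<alpha> x k * (- x / vq ^ (2 * k + 2))"
proof -
  have "Suc k * (Suc k + 1) = k * (k + 1) + (2 * k + 2)" by simp
  thus ?thesis unfolding \<alpha>_def by (simp only: power_add power_Suc) simp
qed

lemma unit_\<alpha>: "unit_at P x \<Longrightarrow> unit_at P (\<alpha> x k)"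
  unfolding \<alpha>_def by (intro unit_at_divide unit_at_power unit_at_uminus unit_vars)

lemma q_power_split: "Suc k \<le> N \<Longrightarrow> (vq ^ 2) ^ (N - Suc k) * vq ^ (2 * k + 1) = vq ^ n"
proof -
  assume "Suc k \<le> N"
  hence "2 * (N - Suc k) + (2 * k + 1) = n" using N by simp
  thus ?thesis by (metis power_add power_mult)
qed

text \<open>Because q^n is 1 modulo P, the factor of index N - k - 1 is congruent to 1 - x /
  q^(2k+2) = (-x / q^(2k+2)) (1 - (q^2/x) q^(2k)): the last factors of the numerator become the
  first ones of the denominator.\<close>

lemma qpoch_reflect_num:
  assumes x: "unit_at P x" and "k \<le> N"
  shows "cong_at P (qpoch (x / vq) (vq ^ 2) (N - k) * qpoch (vq ^ 2 / x) (vq ^ 2) k * \<alpha> x k) (qpoch (x / vq) (vq ^ 2) N)"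
  using assms(2)
proof (induction k)
  case 0
  show ?case by (simp add: \<alpha>_def, intro cong_intros x unit_at_imp_integral[OF x])
next
  case (Suc k)
  let ?z = "vq ^ (2 * k + 2)"
  have nz: "vq \<noteq> 0" "x \<noteq> 0" using nonzero_vars unit_at_nonzero[OF x] by auto
  have z: "(vq ^ 2) * (vq ^ 2) ^ k = ?z" by (simp add: power_add power_mult power2_eq_square)
  have "x / vq * (vq ^ 2) ^ (N - Suc k) = x / ?z * vq ^ n"
    unfolding q_power_split[OF Suc.prems, symmetric] using nz by (simp add: power_add power2_eq_square)
  moreover have "cong_at P (1 - x / ?z * 1) (1 - x / ?z * vq ^ n)"
    by (intro cong_intros cong_at_sym[OF q_n] unit_at_imp_integral[OF x])
  ultimately have c: "cong_at P (1 - x / ?z) (1 - x / vq * (vq ^ 2) ^ (N - Suc k))" by simp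
  have fac: "(1 - vq ^ 2 / x * (vq ^ 2) ^ k) * (- x / ?z) = 1 - x / ?z"
    unfolding times_divide_eq_left z using nz by (simp add: field_simps)
  have "qpoch (x / vq) (vq ^ 2) (N - Suc k) * qpoch (vq ^ 2 / x) (vq ^ 2) (Suc k) * \<alpha> x (Suc k)
     = qpoch (x / vq) (vq ^ 2) (N - Suc k) * qpoch (vq ^ 2 / x) (vq ^ 2) k * \<alpha> x k * ((1 - vq ^ 2 / x * (vq ^ 2) ^ k) * (- x / ?z))"
    unfolding \<alpha>_Suc qpoch_Suc by (simp only: mult_ac)
  also have "\<dots> = qpoch (x / vq) (vq ^ 2) (N - Suc k) * qpoch (vq ^ 2 / x) (vq ^ 2) k * \<alpha> x k * (1 - x / ?z)"
    unfolding fac ..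
  also have "cong_at P \<dots> (qpoch (x / vq) (vq ^ 2) (N - Suc k) * qpoch (vq ^ 2 / x) (vq ^ 2) k * \<alpha> x k * (1 - x / vq * (vq ^ 2) ^ (N - Suc k)))"
    by (intro cong_at_mult[OF _ c] cong_intros unit_at_imp_integral[OF x] x unit_at_imp_integral[OF unit_\<alpha>[OF x]])
  also have "\<dots> = qpoch (x / vq) (vq ^ 2) (Suc (N - Suc k)) * qpoch (vq ^ 2 / x) (vq ^ 2) k * \<alpha> x k"
    unfolding qpoch_Suc by (simp only: mult_ac)
  also have "Suc (N - Suc k) = N - k" using Suc.prems by simp
  also have "cong_at P (qpoch (x / vq) (vq ^ 2) (N - k) * qpoch (vq ^ 2 / x) (vq ^ 2) k * \<alpha> x k) (qpoch (x / vq) (vq ^ 2) N)"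
    using Suc by simp
  finally show ?case .
qed

text \<open>The converse reflection; the factor pulled out is now -q^(1-2k) / x, which is the
  previous one times q^3 / x^2.\<close>

lemma qpoch_reflect_den:
  assumes x: "unit_at P x" and "k \<le> N"
  shows "cong_at P (qpoch (vq ^ 2 / x) (vq ^ 2) (N - k) * qpoch (x / vq) (vq ^ 2) k * (\<alpha> x k * (vq ^ 3 / x ^ 2) ^ k)) (qpoch (vq ^ 2 / x) (vq ^ 2) N)"
  using assms(2)
proof (induction k)
  case 0
  show ?case by (simp add: \<alpha>_def, intro cong_intros x unit_at_imp_integral[OF x])
next
  case (Suc k)
  let ?z = "vq ^ (2 * k + 2)"
  have nz: "vq \<noteq> 0" "x \<noteq> 0" using nonzero_vars unit_at_nonzero[OF x] by auto
  have z: "(vq ^ 2) ^ k * vq ^ 2 = ?z" by (simp add: power_add power_mult power2_eq_square)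
  have "vq ^ 2 / x * (vq ^ 2) ^ (N - Suc k) = vq ^ 3 / (x * ?z) * vq ^ n"
    unfolding q_power_split[OF Suc.prems, symmetric] using nz by (simp add: power_add power2_eq_square power3_eq_cube)
  moreover have "cong_at P (1 - vq ^ 3 / (x * ?z) * 1) (1 - vq ^ 3 / (x * ?z) * vq ^ n)"
    by (intro cong_intros cong_at_sym[OF q_n] unit_at_imp_integral[OF x] x)
  ultimately have c: "cong_at P (1 - vq ^ 3 / (x * ?z)) (1 - vq ^ 2 / x * (vq ^ 2) ^ (N - Suc k))" by simp
  have fac: "(1 - x / vq * (vq ^ 2) ^ k) * (- x / ?z * (vq ^ 3 / x ^ 2)) = 1 - vq ^ 3 / (x * ?z)"
    unfolding z[symmetric] using nz by (simp add: field_simps power2_eq_square power3_eq_cube)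
  let ?d = "(vq ^ 3 / x ^ 2) ^ k"
  have "qpoch (vq ^ 2 / x) (vq ^ 2) (N - Suc k) * qpoch (x / vq) (vq ^ 2) (Suc k) * (\<alpha> x (Suc k) * (vq ^ 3 / x ^ 2) ^ Suc k)
     = qpoch (vq ^ 2 / x) (vq ^ 2) (N - Suc k) * qpoch (x / vq) (vq ^ 2) k * (\<alpha> x k * ?d) * ((1 - x / vq * (vq ^ 2) ^ k) * (- x / ?z * (vq ^ 3 / x ^ 2)))"
    unfolding \<alpha>_Suc qpoch_Suc power_Suc by (simp only: mult_ac)
  also have "\<dots> = qpoch (vq ^ 2 / x) (vq ^ 2) (N - Suc k) * qpoch (x / vq) (vq ^ 2) k * (\<alpha> x k * ?d) * (1 - vq ^ 3 / (x * ?z))"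
    unfolding fac ..
  also have "cong_at P \<dots> (qpoch (vq ^ 2 / x) (vq ^ 2) (N - Suc k) * qpoch (x / vq) (vq ^ 2) k * (\<alpha> x k * ?d) * (1 - vq ^ 2 / x * (vq ^ 2) ^ (N - Suc k)))"
    by (intro cong_at_mult[OF _ c] cong_intros unit_at_imp_integral[OF x] x unit_at_imp_integral[OF unit_\<alpha>[OF x]])
  also have "\<dots> = qpoch (vq ^ 2 / x) (vq ^ 2) (Suc (N - Suc k)) * qpoch (x / vq) (vq ^ 2) k * (\<alpha> x k * ?d)"
    unfolding qpoch_Suc by (simp only: mult_ac)
  also have "Suc (N - Suc k) = N - k" using Suc.prems by simp
  also have "cong_at P (qpoch (vq ^ 2 / x) (vq ^ 2) (N - k) * qpoch (x / vq) (vq ^ 2) k * (\<alpha> x k * ?d)) (qpoch (vq ^ 2 / x) (vq ^ 2) N)"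
    using Suc by simp
  finally show ?case .
qed

text \<open>The quotient of the two reflections. The products (x/q; q^2)_k are not known to be
  units, so only products of (q^2/x) are ever divided by.\<close>

lemma poised_ratio_reflect:
  assumes p: "poised x" and k: "k \<le> N"
  shows "cong_at P (poised_ratio vq x (N - k)) (\<alpha> x N * poised_ratio vq x k * (vq ^ 3 / x ^ 2) ^ k)"
proof -
  have x: "unit_at P x" using p by (simp add: poised_def)
  define X1 V1 U V XN VN A D where defs: "X1 = qpoch (x / vq) (vq ^ 2) (N - k)" "V1 = qpoch (vq ^ 2 / x) (vq ^ 2) (N - k)"
     "U = qpoch (x / vq) (vq ^ 2) k" "V = qpoch (vq ^ 2 / x) (vq ^ 2) k" "XN = qpoch (x / vq) (vq ^ 2) N"
     "VN = qpoch (vq ^ 2 / x) (vq ^ 2) N" "A = \<alpha> x k" "D = (vq ^ 3 / x ^ 2) ^ k"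
  have u: "unit_at P V1" "unit_at P V" "unit_at P VN"
    unfolding defs by (rule poised_unit_qpoch[OF p]; use k in simp)+
  note nz = u[THEN unit_at_nonzero]
  have AD: "unit_at P A" "unit_at P D" unfolding defs by (intro unit_\<alpha> x unit_at_power unit_at_divide unit_vars)+
  have qi: "integral_at P (qpoch (x / vq) (vq ^ 2) m)" for m
    by (intro integral_at_qpoch integral_at_divide integral_at_power integral_vars unit_vars unit_at_imp_integral[OF x])
  have int: "integral_at P X1" "integral_at P U" "integral_at P XN" unfolding defs by (rule qi)+
  note ints = int[THEN cong_at_refl] u[THEN unit_at_imp_integral, THEN cong_at_refl] AD[THEN unit_at_imp_integral, THEN cong_at_refl]
  have 1: "cong_at P (X1 * V * A) XN" unfolding defs by (rule qpoch_reflect_num[OF x k])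
  have 2: "cong_at P (V1 * U * (A * D)) VN" unfolding defs by (rule qpoch_reflect_den[OF x k])
  \<comment> \<open>The case k = N of the numerator reflection supplies the constant
    \<open>\<alpha> x N\<close>.\<close>
  have 3: "cong_at P (VN * \<alpha> x N) XN"
    using qpoch_reflect_num[OF x order.refl] unfolding defs by simp
  have "X1 / V1 = X1 * VN / (V1 * VN)" using nz by simp
  also have "cong_at P \<dots> (X1 * (V1 * U * (A * D)) / (V1 * VN))"
    by (intro cong_at_divide[OF not_unit] cong_at_mult ints cong_at_sym[OF 2] unit_at_mult u)
  also have "\<dots> = (X1 * V * A) * U * D / (VN * V)" using nz by (simp add: field_simps)
  also have "cong_at P \<dots> (XN * U * D / (VN * V))"
    by (intro cong_at_divide[OF not_unit] cong_at_mult ints 1 unit_at_mult u)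
  also have "cong_at P \<dots> (VN * \<alpha> x N * U * D / (VN * V))"
    by (intro cong_at_divide[OF not_unit] cong_at_mult ints cong_at_sym[OF 3] unit_at_mult u)
  also have "\<dots> = \<alpha> x N * (U / V) * D" using nz by simp
  finally show ?thesis unfolding poised_ratio_def defs .
qed

lemma cong_poised_ratio: "poised x \<Longrightarrow> k \<le> N \<Longrightarrow> cong_at P (poised_ratio vq x k) (poised_ratio vq x k)"
  unfolding poised_ratio_def
  by (intro cong_intros poised_unit_qpoch) (auto simp: poised_def intro: unit_at_imp_integral)

lemma q_power_n_mult: "cong_at P (vq ^ (n * m)) 1"
  using cong_at_power[OF q_n, of m] by (simp add: power_mult)

text \<open>The exponents match because \<open>6 N\<^sup>2 - N - 1 = n (3 N + 1)\<close> when \<open>n = 2 N - 1\<close>.\<close>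

lemma lhs_term_reflect:
  assumes k: "k \<le> N"
  shows "cong_at P (lhs_term vq va vb vc vd (N - k)) (- lhs_term vq va vb vc vd k)"
proof -
  define r where "r = poised_ratio vq va k * poised_ratio vq (inverse va) k * poised_ratio vq (inverse vb) k 
     * poised_ratio vq vc k * poised_ratio vq vd k * poised_ratio vq 1 k"
  \<comment> \<open>The product of the six parameters a, 1/a, 1/b, c, d, 1; the argument of the
    series is q^7 / w.\<close>
  define w where "w = vc * vd / vb"
  define Q where "Q = vq ^ k"
  have nz: "vq \<noteq> 0" "va \<noteq> 0" "vb \<noteq> 0" "vc \<noteq> 0" "vd \<noteq> 0" "w \<noteq> 0" "Q \<noteq> 0" 
    using nonzero_vars by (auto simp: w_def Q_def)
  have w: "unit_at P w" unfolding w_def by (intro unit_at_mult unit_at_divide unit_vars)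
  have r: "cong_at P r r" unfolding r_def by (intro cong_at_mult cong_poised_ratio poised_vars k)
  have wq: "vb * vq ^ 7 / (vc * vd) = vq ^ 7 / w" using nz by (simp add: w_def)
  have qi: "qint vq (4 * int m - 1) = (1 - vq ^ (4 * m) / vq) / (1 - vq)" for m
    unfolding qint_def powi_4k_minus_1[OF nz(1)] by (simp add: divide_inverse mult.commute flip: power_mult)
  \<comment> \<open>Six parameters, so the signs cancel.\<close>
  have A: "\<alpha> va N * \<alpha> (inverse va) N * \<alpha> (inverse vb) N * \<alpha> vc N * \<alpha> vd N * \<alpha> 1 N = w ^ N / vq ^ (6 * (N * (N + 1)))"
  proof -
    have "\<alpha> va N * \<alpha> (inverse va) N * \<alpha> (inverse vb) N * \<alpha> vc N * \<alpha> vd N * \<alpha> 1 N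
      = ((- va) * (- inverse va) * (- inverse vb) * (- vc) * (- vd) * (- 1)) ^ N / (vq ^ (N * (N + 1))) ^ 6"
    proof -
      have "x1 ^ N / t * (x2 ^ N / t) * (x3 ^ N / t) * (x4 ^ N / t) * (x5 ^ N / t) * (x6 ^ N / t) = (x1 * x2 * x3 * x4 * x5 * x6) ^ N / t ^ 6"
        for x1 x2 x3 x4 x5 x6 t :: "R fract"
        by (simp add: power_mult_distrib eval_nat_numeral mult_ac)
      thus ?thesis unfolding \<alpha>_def .
    qed
    also have "(- va) * (- inverse va) * (- inverse vb) * (- vc) * (- vd) * (- 1) = w"
      using nz by (simp add: w_def field_simps)
    finally show ?thesis by (simp add: mult.commute flip: power_mult)
  qed
  have D: "(vq ^ 3 / va ^ 2) ^ k * (vq ^ 3 / (inverse va) ^ 2) ^ k * (vq ^ 3 / (inverse vb) ^ 2) ^ k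
      * (vq ^ 3 / vc ^ 2) ^ k * (vq ^ 3 / vd ^ 2) ^ k * (vq ^ 3 / 1 ^ 2) ^ k = (vq ^ 18 / w ^ 2) ^ k"
  proof -
    have "(vq ^ 3 / va ^ 2) * (vq ^ 3 / (inverse va) ^ 2) * (vq ^ 3 / (inverse vb) ^ 2)
      * (vq ^ 3 / vc ^ 2) * (vq ^ 3 / vd ^ 2) * (vq ^ 3 / 1 ^ 2) = vq ^ 18 / w ^ 2"
    proof -
      have "t / x ^ 2 * (t / (inverse x) ^ 2) * (t / (inverse y) ^ 2) * (t / u ^ 2) * (t / v ^ 2) * (t / 1 ^ 2) = t ^ 6 / (u * v / y) ^ 2"
        if "x \<noteq> 0" "y \<noteq> 0" "u \<noteq> 0" "v \<noteq> 0" for t x y u v :: "R fract"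
        using that by (simp add: divide_simps eval_nat_numeral)
      from this[OF nz(2-5), of "vq ^ 3"] show ?thesis unfolding w_def by (simp flip: power_mult)
    qed
    thus ?thesis by (simp only: flip: power_mult_distrib)
  qed
  have c1: "cong_at P (lhs_term vq va vb vc vd (N - k)) (qint vq (4 * int (N - k) - 1) * ((\<alpha> va N * poised_ratio vq va k * (vq ^ 3 / va ^ 2) ^ k)
      * (\<alpha> (inverse va) N * poised_ratio vq (inverse va) k * (vq ^ 3 / (inverse va) ^ 2) ^ k)
      * (\<alpha> (inverse vb) N * poised_ratio vq (inverse vb) k * (vq ^ 3 / (inverse vb) ^ 2) ^ k)
      * (\<alpha> vc N * poised_ratio vq vc k * (vq ^ 3 / vc ^ 2) ^ k)
      * (\<alpha> vd N * poised_ratio vq vd k * (vq ^ 3 / vd ^ 2) ^ k)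
      * (\<alpha> 1 N * poised_ratio vq 1 k * (vq ^ 3 / 1 ^ 2) ^ k)) * (vq ^ 7 / w) ^ (N - k))"
    unfolding lhs_term_poised_ratio[of _ _ _ _ _ "N - k"] wq
    by (intro cong_at_mult cong_qint poised_ratio_reflect poised_vars k cong_intros w unit_at_imp_integral[OF w])
  have regroup: "x * ((a1 * p1 * d1) * (a2 * p2 * d2) * (a3 * p3 * d3) * (a4 * p4 * d4) * (a5 * p5 * d5) * (a6 * p6 * d6)) * z
      = x * ((a1 * a2 * a3 * a4 * a5 * a6) * (d1 * d2 * d3 * d4 * d5 * d6) * z) * (p1 * p2 * p3 * p4 * p5 * p6)"
    for x z a1 a2 a3 a4 a5 a6 p1 p2 p3 p4 p5 p6 d1 d2 d3 d4 d5 d6 :: "R fract"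
    by (simp only: mult_ac)
  \<comment> \<open>The exponents of w add up to N - 2k - (N - k) = -k; those of q leave 11k apart
    from -1 and a multiple of n.\<close>
  have c2: "w ^ N / vq ^ (6 * (N * (N + 1))) * (vq ^ 18 / w ^ 2) ^ k * (vq ^ 7 / w) ^ (N - k) = Q ^ 11 / (w ^ k * vq * vq ^ (n * (3 * N + 1)))"
  proof -
    have wN: "w ^ N = w ^ (N - k) * w ^ k" using k by (simp flip: power_add)
    have "7 * N + 1 + n * (3 * N + 1) = 6 * (N * (N + 1))"
    proof -
      have "n = 2 * N - 1" "N > 0" using N by auto
      then obtain m where "N = Suc m" "n = 2 * m + 1" by (cases N) auto
      thus ?thesis by (simp add: algebra_simps)
    qed
    hence "vq ^ (6 * (N * (N + 1))) = vq ^ (7 * N + 1 + n * (3 * N + 1))" by (simp only:)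
    hence e1: "vq ^ (6 * (N * (N + 1))) = vq ^ (7 * N) * (vq * vq ^ (n * (3 * N + 1)))"
      by (simp only: power_add power_one_right mult.assoc)
    have e2: "vq ^ (7 * N) = (vq ^ 7) ^ (N - k) * Q ^ 7"
    proof -
      have "7 * N = 7 * (N - k) + k * 7" using k by simp
      hence "vq ^ (7 * N) = vq ^ (7 * (N - k) + k * 7)" by simp
      thus ?thesis unfolding Q_def power_add power_mult .
    qed
    have e3: "(vq ^ 18) ^ k = Q ^ 7 * Q ^ 11" unfolding Q_def by (simp add: mult.commute flip: power_mult power_add)
    have e4: "(w ^ 2) ^ k = w ^ k * w ^ k" by (simp add: power2_eq_square power_mult_distrib)
    have gen: "x * y / (u * s * (v * z)) * (s * t / (y * y)) * (u / x) = t / (y * v * z)"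
      if "x \<noteq> 0" "y \<noteq> 0" "u \<noteq> 0" "s \<noteq> 0" for x y u s t v z :: "R fract"
      using that by simp
    show ?thesis unfolding power_divide wN e1 e2 e3 e4 by (rule gen) (use nz in simp_all)
  qed
  \<comment> \<open>From 2N = n + 1 one gets 4(N - k) - 1 = 2n + 1 - 4k.\<close>
  have c3: "vq ^ (4 * (N - k)) / vq = vq ^ (n * 2) * vq / Q ^ 4"
  proof -
    have "vq ^ (4 * (N - k)) * Q ^ 4 = vq ^ (n * 2) * vq * vq"
    proof -
      have "4 * (N - k) + k * 4 = n * 2 + 1 + 1" using k N by simp
      hence "vq ^ (4 * (N - k) + k * 4) = vq ^ (n * 2 + 1 + 1)" by simp
      hence "vq ^ (4 * (N - k)) * (vq ^ (k * 4)) = vq ^ (n * 2) * vq * vq" by (simp only: power_add power_one_right)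
      thus ?thesis unfolding Q_def power_mult .
    qed
    thus ?thesis using nz by (simp add: field_simps)
  qed
  have c4: "cong_at P ((1 - vq ^ (n * 2) * vq / Q ^ 4) / (1 - vq) * (Q ^ 11 / (w ^ k * vq * vq ^ (n * (3 * N + 1)))) * r)
     ((1 - 1 * vq / Q ^ 4) / (1 - vq) * (Q ^ 11 / (w ^ k * vq * 1)) * r)"
    unfolding Q_def by (intro cong_at_mult[OF _ r] cong_at_mult cong_at_divide[OF not_unit] cong_at_diff q_power_n_mult cong_at_refl 
       integral_at_1 integral_vars integral_at_power unit_1_minus_q unit_at_mult unit_at_power w unit_at_imp_integral[OF w] unit_vars)
  \<comment> \<open>The origin of the minus sign: 1 - q/Q^4 = -(q/Q^4)(1 - Q^4/q). The lost Q^4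
    reduces Q^11 to the Q^7 of the term with index k.\<close>
  have c5: "(1 - 1 * vq / Q ^ 4) / (1 - vq) * (Q ^ 11 / (w ^ k * vq * 1)) * r = - ((1 - Q ^ 4 / vq) / (1 - vq) * r * (Q ^ 7 / w ^ k))"
  proof -
    have "(1 - 1 * vq / Q ^ 4) * (Q ^ 11 / (w ^ k * vq * 1)) = - ((1 - Q ^ 4 / vq) * (Q ^ 7 / w ^ k))"
    proof -
      have gen: "(1 - 1 * v / s) * (s * t / (u * v * 1)) = - ((1 - s / v) * (t / u))"
        if "s \<noteq> 0" "u \<noteq> 0" "v \<noteq> 0" for s t u v :: "R fract"
        using that by (simp add: field_simps)
      have Q: "Q ^ 11 = Q ^ 4 * Q ^ 7" by (simp flip: power_add)
      show ?thesis unfolding Q by (rule gen) (use nz in simp_all)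
    qed
    moreover have "x / y * z * r = - (x' / y * r * z')" if "x * z = - (x' * z')" for x y z x' z' :: "R fract"
    proof -
      have "x / y * z * r = (x * z) / y * r" by simp
      thus ?thesis unfolding that by simp
    qed
    ultimately show ?thesis by blast
  qed
  have c6: "(1 - Q ^ 4 / vq) / (1 - vq) * r * (Q ^ 7 / w ^ k) = lhs_term vq va vb vc vd k"
    unfolding lhs_term_poised_ratio wq qi r_def[symmetric] Q_def by (simp add: power_divide mult.commute flip: power_mult)
  show ?thesis
    using cong_at_trans[OF c1[unfolded regroup A D c2 qi c3 r_def[symmetric]] c4[unfolded c5 c6]] .
qed

end

context cyclotomic_modulus
begin

lemma lhs_term_cong_0:
  assumes "N < k" "k < n"
  shows "cong_at P (lhs_term vq va vb vc vd k) 0"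
proof -
  have q0: "vq \<noteq> 0" using nonzero_vars by blast
  obtain m where m: "k = N + Suc m" using assms(1) less_imp_Suc_add by auto
  have "inverse vq * (vq ^ 2) ^ N = vq ^ n" using q0 N by (simp flip: power_mult)
  hence "qpoch (inverse vq) (vq ^ 2) k = qpoch (inverse vq) (vq ^ 2) N * qpoch (vq ^ n) (vq ^ 2) (Suc m)"
    unfolding m qpoch_add by simp
  also have "cong_at P \<dots> (qpoch (inverse vq) (vq ^ 2) N * qpoch 1 (vq ^ 2) (Suc m))"
    by (intro cong_intros q_n)
  also have "\<dots> = 0" by (simp add: qpoch_Suc')
  finally have 0: "cong_at P (qpoch (inverse vq) (vq ^ 2) k) 0" .
  \<comment> \<open>For k < n the denominator is still a unit, so the zero of the numerator
    survives.\<close>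
  have "unit_at P (1 - vq ^ 2 * (vq ^ 2) ^ j)" if "j < k" for j using that assms(2) by (intro unit_factor_q) auto
  hence "cong_at P (lhs_term vq va vb vc vd k) (qint vq (4 * int k - 1)
       * (qpoch (va / vq) (vq ^ 2) k * qpoch (inverse (vq * va)) (vq ^ 2) k
          * qpoch (inverse (vq * vb)) (vq ^ 2) k * qpoch (vc / vq) (vq ^ 2) k
          * qpoch (vd / vq) (vq ^ 2) k * 0)
       / (qpoch (vq ^ 2 / va) (vq ^ 2) k * qpoch (va * vq ^ 2) (vq ^ 2) k
          * qpoch (vb * vq ^ 2) (vq ^ 2) k * qpoch (vq ^ 2 / vc) (vq ^ 2) k
          * qpoch (vq ^ 2 / vd) (vq ^ 2) k * qpoch (vq ^ 2) (vq ^ 2) k)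
       * (vb * vq ^ 7 / (vc * vd)) ^ k)"
    unfolding lhs_term_def by (intro 0 cong_intros cong_qint unit_factors)
  thus ?thesis by simp
qed

lemma sum_lhs_term_cong_0:
  assumes M: "N \<le> M" "M < n"
  shows "cong_at P (\<Sum>k=0..M. lhs_term vq va vb vc vd k) 0"
proof -
  let ?T = "lhs_term vq va vb vc vd"
  define S where "S = (\<Sum>k\<le>N. ?T k)"
  have T: "integral_at P (?T k)" if "k < n" for k
    using that by (intro cong_at_imp_integral(1)[OF cong_lhs_term[OF cong_at_refl cong_at_refl]] integral_vars)
  have S: "cong_at P S S" unfolding S_def using N_less by (intro cong_at_sum cong_at_refl T) auto
  have "S = (\<Sum>k\<le>N. ?T (N - k))" unfolding S_def
    by (rule sum.reindex_bij_witness[of _ "\<lambda>k. N - k" "\<lambda>k. N - k"]) auto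
  also have "cong_at P \<dots> (\<Sum>k\<le>N. - ?T k)" by (intro cong_at_sum lhs_term_reflect) auto
  also have "\<dots> = - S" by (simp add: S_def sum_negf)
  \<comment> \<open>Twice S is congruent to 0, and 2 is a unit.\<close>
  finally have "cong_at P (S + S) (- S + S)" using S by (rule cong_at_add)
  hence "cong_at P ((S + S) / 2) ((- S + S) / 2)"
    by (intro cong_at_divide[OF not_unit] cong_at_refl unit_at_imp_integral unit_2)
  moreover have "(2 :: R fract) \<noteq> 0" using unit_at_nonzero[OF unit_2] .
  ultimately have S0: "cong_at P S 0" by (simp flip: mult_2)
  have "(\<Sum>k=0..M. ?T k) = S + (\<Sum>k\<in>{N<..M}. ?T k)"
  proof -
    have "{0..M} = {..N} \<union> {N<..M}" using M by auto
    thus ?thesis unfolding S_def by (simp add: sum.union_disjoint ivl_disj_int)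
  qed
  also have "cong_at P \<dots> (0 + (\<Sum>k\<in>{N<..M}. 0))"
    using M by (intro cong_at_add S0 cong_at_sum lhs_term_cong_0) auto
  finally show ?thesis by simp
qed

text \<open>That [n] vanishes suffices because Theta and the sum are integral, which enters as
  reflexivity of their congruences.\<close>

lemma rhs_cong_0: "cong_at P (qint vq (int n) * Theta vq va vb n * (\<Sum>k=0..N. rhs_term vq va vb vc vd k)) 0"
proof -
  have "cong_at P ((1 - vq ^ n) / (1 - vq)) ((1 - 1) / (1 - vq))"
    by (intro cong_intros q_n unit_1_minus_q)
  hence 1: "cong_at P (qint vq (int n)) 0" by (simp add: qint_def)
  have refl: "cong_at P va va" "cong_at P vb vb" by (intro cong_at_refl integral_vars)+
  have "cong_at P (qint vq (int n) * Theta vq va vb n * (\<Sum>k=0..N. rhs_term vq va vb vc vd k))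
     (0 * Theta vq va vb n * (\<Sum>k=0..N. rhs_term vq va vb vc vd k))"
    using N_less by (intro cong_at_mult 1 cong_Theta refl cong_at_sum cong_rhs_term) auto
  thus ?thesis by simp
qed

end

section \<open>Assembly of the four congruences\<close>

text \<open>A divisor of 2 is constant, and a constant dividing Phi_n divides X^n - 1, so it is a
  unit.\<close>

lemma coprime_2_cyclo_q: "n > 0 \<Longrightarrow> coprime 2 (cyclo_q n)"
proof -
  assume n: "n > 0"
  obtain E :: "R \<Rightarrow> int poly" where E: "ring_morphism E" "\<And>f. E [:[:[:[:f:]:]:]:] = f"
    using exists_evaluation[OF ring_morphism_id, of 0 0 0 0] by blast
  interpret ring_morphism E by fact
  have E2: "E 2 = 2" using hom_add[of 1 1] by (simp add: hom_1)
  have "coprime 2 (cyclotomic n)"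
  proof (rule coprimeI)
    fix f assume f: "f dvd (2 :: int poly)" "f dvd cyclotomic n"
    have "f dvd [:2:]" using f(1) by (simp add: numeral_poly)
    then obtain c where c: "f = [:c:]" by (rule dvd_const_polyE) auto
    have "f dvd root_poly n" using f(2) cyclotomic_dvd_root_poly[OF n] dvd_trans by blast
    thus "is_unit f" using const_dvd_root_poly[OF n] by (simp add: c is_unit_const_poly_iff)
  qed
  thus ?thesis unfolding cyclo_q_def using E2 cyclotomic_neq_0[OF n]
    by (intro coprime_const_of_evaluation[OF E]) auto
qed

lemma cyclo_q_dvd: "n > 0 \<Longrightarrow> cyclo_q n dvd Xq ^ n - 1"
proof -
  assume n: "n > 0"
  have "Xq ^ n - 1 = [:[:[:[:root_poly n:]:]:]:]"
    unfolding Xq_power by (simp add: monom_altdef one_pCons)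
  thus ?thesis using cyclotomic_dvd_root_poly[OF n] by (simp add: cyclo_q_def)
qed

lemma congruence_cyclo_q:
  assumes "odd n" "n > 1" "2 * N = Suc n" "N \<le> M" "M < n"
  shows "cong_rat (\<Sum>k=0..M. lhs_term vq va vb vc vd k)
     (qint vq (int n) * Theta vq va vb n * (\<Sum>k=0..N. rhs_term vq va vb vc vd k)) (cyclo_q n)"
\<comment> \<open>The locale \<open>good_modulus\<close> demands a non-unit; modulo a unit every
  congruence holds.\<close>
proof (cases "is_unit (cyclo_q n)")
  case True
  thus ?thesis by (rule cong_rat_unit_modulus)
next
  case False
  interpret good_modulus n "cyclo_q n" by (rule good_modulus_cyclo_q[OF assms(1,2) False])
  interpret cyclotomic_modulus n "cyclo_q n" N
  proof
    show "cong_at (cyclo_q n) (vq ^ n) 1"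
      using cong_at_of_dvd[OF cyclo_q_dvd[of n]] assms(2) by (simp add: vq_def Fract_power One_fract_def)
    have "(2 :: R fract) = Fract 2 1" using of_nat_fract[of 2, where 'a = R] by simp
    thus "unit_at (cyclo_q n) 2" using unit_of_coprime[OF coprime_2_cyclo_q[of n]] assms(2) by simp
  qed (use assms in auto)
  show ?thesis
    using sum_lhs_term_cong_0[OF assms(4,5)] rhs_cong_0 cong_at_trans cong_at_sym cong_at_imp_cong_rat by blast
qed

lemma Fract_neq_of_evaluation:
  assumes "E X \<noteq> E Y" shows "Fract X 1 \<noteq> Fract (Y :: R) 1"
  using assms by (auto simp: eq_fract)

text \<open>The exact non-degeneracy conditions of Watson's formula; one real point, q = 2 and -1
  elsewhere, separates all pairs.\<close>

lemma generic_variables: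
  fixes n :: nat assumes "odd n"
  shows "0 < i \<Longrightarrow> vq ^ i \<noteq> 1" "vq ^ n \<noteq> vq ^ (2 * j)" "va \<noteq> vq ^ i" "vb \<noteq> vq ^ i" "vc \<noteq> vq ^ i" "vd \<noteq> vq ^ i"
    "va * vq ^ i \<noteq> 1" "vb * vq ^ i \<noteq> 1" "vb * vq ^ i \<noteq> vq ^ m"
    "vq \<noteq> 0" "va \<noteq> 0" "vb \<noteq> 0" "vc \<noteq> 0" "vd \<noteq> 0"
proof -
  obtain E :: "R \<Rightarrow> real" where E: "ring_morphism E" "E Xq = 2" "E Xa = -1" "E Xb = -1" "E Xc = -1" "E Xd = -1"
    using exists_real_evaluation[of 2 "-1" "-1" "-1" "-1"] by blast
  interpret ring_morphism E by fact
  have p: "- 1 \<noteq> (2::real) ^ k" "- (2 ^ k) \<noteq> (1::real)" "- (2 ^ k) \<noteq> (2::real) ^ l" for k l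
    using zero_less_power[of "2::real" k] zero_less_power[of "2::real" l] by linarith+
  note s = vq_def va_def vb_def vc_def vd_def Fract_power One_fract_def Zero_fract_def mult_fract mult_1_right
  note r = Fract_neq_of_evaluation[of E]
  show "vq ^ i \<noteq> 1" if "0 < i"
  proof -
    have "1 < (2::real) ^ i" using that by (intro one_less_power) auto
    hence "(2::real) ^ i \<noteq> 1" by linarith
    thus ?thesis unfolding s by (intro r) (simp only: hom_simps E not_False_eq_True)
  qed
  show "vq ^ n \<noteq> vq ^ (2 * j)" unfolding s
    by (intro r) (use parity_power_neq[OF assms, of j] in \<open>simp only: hom_simps E not_False_eq_True\<close>)
  show "va \<noteq> vq ^ i" "vb \<noteq> vq ^ i" "vc \<noteq> vq ^ i" "vd \<noteq> vq ^ i"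
    "va * vq ^ i \<noteq> 1" "vb * vq ^ i \<noteq> 1" "vb * vq ^ i \<noteq> vq ^ m"
    "vq \<noteq> 0" "va \<noteq> 0" "vb \<noteq> 0" "vc \<noteq> 0" "vd \<noteq> 0"
    unfolding s by (intro r; simp add: hom_simps E p p[symmetric])+
qed

lemma congruence_linear:
  assumes "odd n" "n > 1" "2 * N = Suc n" "N \<le> M" "M < n"
  shows "cong_rat (\<Sum>k=0..M. lhs_term vq va vb vc vd k)
     (qint vq (int n) * Theta vq va vb n * (\<Sum>k=0..N. rhs_term vq va vb vc vd k)) (Xa - Xq ^ n)" (is ?A)
  and "cong_rat (\<Sum>k=0..M. lhs_term vq va vb vc vd k)
     (qint vq (int n) * Theta vq va vb n * (\<Sum>k=0..N. rhs_term vq va vb vc vd k)) (1 - Xa * Xq ^ n)" (is ?A')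
  and "cong_rat (\<Sum>k=0..M. lhs_term vq va vb vc vd k)
     (qint vq (int n) * Theta vq va vb n * (\<Sum>k=0..N. rhs_term vq va vb vc vd k)) (Xb - Xq ^ n)" (is ?B)
proof -
  note g = generic_variables[OF assms(1)]
  have Nn: "N < n" using assms by simp
  show ?A
  proof -
    interpret good_modulus n "Xa - Xq ^ n" by (rule good_modulus_a_minus[OF assms(1)])
    have "cong_at (Xa - Xq ^ n) va (vq ^ n)"
      unfolding va_def vq_def Fract_power by (rule cong_at_of_dvd) simp
    moreover have "(\<Sum>k=0..M. lhs_term vq (vq ^ n) vb vc vd k)
       = qint vq (int n) * Theta vq (vq ^ n) vb n * (\<Sum>k=0..N. rhs_term vq (vq ^ n) vb vc vd k)"
      by (rule transformation_at_a[OF assms(3,4)]) (use g g(4)[of n, symmetric] g(8)[of n] in \<open>auto simp: mult.commute\<close>)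
    ultimately show ?thesis
      by (intro cong_at_imp_cong_rat cong_of_specialisation[OF _ cong_at_refl[OF integral_vars(3)] assms(5) Nn])
  qed
  show ?A'
  proof -
    interpret good_modulus n "1 - Xa * Xq ^ n" by (rule good_modulus_1_minus_a[OF assms(1)])
    \<comment> \<open>Here only a q^n is congruent to 1; dividing by the unit q^n yields the value
      q^(-n) for a.\<close>
    have "cong_at (1 - Xa * Xq ^ n) (va * vq ^ n) 1"
      unfolding va_def vq_def Fract_power mult_fract One_fract_def mult_1_right 
      by (rule cong_at_of_dvd) (use dvd_minus_iff[of "1 - Xa * Xq ^ n" "1 - Xa * Xq ^ n"] in simp)
    hence "cong_at (1 - Xa * Xq ^ n) (va * vq ^ n / vq ^ n) (1 / vq ^ n)"
      by (intro cong_intros)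
    hence "cong_at (1 - Xa * Xq ^ n) va (inverse (vq ^ n))" using g(10) by (simp add: inverse_eq_divide)
    moreover have "(\<Sum>k=0..M. lhs_term vq (inverse (vq ^ n)) vb vc vd k)
       = qint vq (int n) * Theta vq (inverse (vq ^ n)) vb n * (\<Sum>k=0..N. rhs_term vq (inverse (vq ^ n)) vb vc vd k)"
      by (rule transformation_at_a[OF assms(3,4)]) (use g g(4)[of n, symmetric] g(8)[of n] in \<open>auto simp: field_simps\<close>)
    ultimately show ?thesis
      by (intro cong_at_imp_cong_rat cong_of_specialisation[OF _ cong_at_refl[OF integral_vars(3)] assms(5) Nn])
  qed
  show ?B
  proof -
    interpret good_modulus n "Xb - Xq ^ n" by (rule good_modulus_b_minus[OF assms(1)])
    have "cong_at (Xb - Xq ^ n) vb (vq ^ n)"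
      unfolding vb_def vq_def Fract_power by (rule cong_at_of_dvd) simp
    moreover have "(\<Sum>k=0..M. lhs_term vq va (vq ^ n) vc vd k)
       = qint vq (int n) * Theta vq va (vq ^ n) n * (\<Sum>k=0..N. rhs_term vq va (vq ^ n) vc vd k)"
      by (rule transformation_at_b[OF assms(3,4)]) (use g in auto)
    ultimately show ?thesis
      by (intro cong_at_imp_cong_rat cong_of_specialisation[OF cong_at_refl[OF integral_vars(2)] _ assms(5) Nn])
  qed
qed

text \<open>In each pair one prime factor has a zero at which the other does not vanish; for a = q^n
  the value of 1 - a q^n at q = 2 is 1 - 4^n.\<close>

lemma coprime_linear_moduli:
  assumes "n > 0"
  shows "coprime (1 - Xa * Xq ^ n) (Xa - Xq ^ n)" "coprime (1 - Xa * Xq ^ n) (Xb - Xq ^ n)" "coprime (Xa - Xq ^ n) (Xb - Xq ^ n)"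
proof -
  obtain E :: "R \<Rightarrow> real" where E: "ring_morphism E" "E Xq = 2" "E Xa = 2 ^ n" "E Xb = -1" "E Xc = -1" "E Xd = -1"
    using exists_real_evaluation[of 2 "2 ^ n" "-1" "-1" "-1"] by blast
  interpret E: ring_morphism E by fact
  have "1 < (2::real) ^ (n + n)" using assms by (intro one_less_power) auto
  hence "1 - 2 ^ n * (2::real) ^ n \<noteq> 0" by (simp add: power_add)
  thus "coprime (1 - Xa * Xq ^ n) (Xa - Xq ^ n)"
    by (intro coprime_prime_of_evaluation[OF prime_elem_a_minus E(1)]) (simp_all only: E.hom_simps E not_False_eq_True diff_self)
  obtain F :: "R \<Rightarrow> real" where F: "ring_morphism F" "F Xq = 2" "F Xa = -1" "F Xb = 2 ^ n" "F Xc = -1" "F Xd = -1"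
    using exists_real_evaluation[of 2 "-1" "2 ^ n" "-1" "-1"] by blast
  interpret F: ring_morphism F by fact
  have "0 < (2::real) ^ n" by simp
  hence "1 - (- 1) * (2::real) ^ n \<noteq> 0" "- 1 - (2::real) ^ n \<noteq> 0" by linarith+
  thus "coprime (1 - Xa * Xq ^ n) (Xb - Xq ^ n)" "coprime (Xa - Xq ^ n) (Xb - Xq ^ n)"
    by (intro coprime_prime_of_evaluation[OF prime_elem_b_minus F(1)]; simp only: F.hom_simps F not_False_eq_True diff_self)+
qed

theorem theorem3p1:
  fixes n M :: nat
  assumes "odd n" and "n > 1" and "M = (n + 1) div 2 \<or> M = n - 1"
  shows "cong_rat
    (\<Sum>k=0..M. qint vq (4 * int k - 1)
       * (qpoch (va / vq) (vq ^ 2) k * qpoch (inverse (vq * va)) (vq ^ 2) k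
          * qpoch (inverse (vq * vb)) (vq ^ 2) k * qpoch (vc / vq) (vq ^ 2) k
          * qpoch (vd / vq) (vq ^ 2) k * qpoch (inverse vq) (vq ^ 2) k)
       / (qpoch (vq ^ 2 / va) (vq ^ 2) k * qpoch (va * vq ^ 2) (vq ^ 2) k
          * qpoch (vb * vq ^ 2) (vq ^ 2) k * qpoch (vq ^ 2 / vc) (vq ^ 2) k
          * qpoch (vq ^ 2 / vd) (vq ^ 2) k * qpoch (vq ^ 2) (vq ^ 2) k)
       * (vb * vq ^ 7 / (vc * vd)) ^ k)
    (qint vq (int n) * Theta vq va vb n *
     (\<Sum>k=0..(n + 1) div 2.
        (qpoch (va / vq) (vq ^ 2) k * qpoch (inverse (vq * va)) (vq ^ 2) k
         * qpoch (inverse (vq * vb)) (vq ^ 2) k * qpoch (vq ^ 3 / (vc * vd)) (vq ^ 2) k)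
        / (qpoch (vq ^ 2) (vq ^ 2) k * qpoch (inverse (vq ^ 2 * vb)) (vq ^ 2) k
           * qpoch (vq ^ 2 / vc) (vq ^ 2) k * qpoch (vq ^ 2 / vd) (vq ^ 2) k)
        * vq ^ (2 * k)))
    (cyclo_q n * (1 - Xa * Xq ^ n) * (Xa - Xq ^ n) * (Xb - Xq ^ n))"
proof -
  define N where "N = (n + 1) div 2"
  \<comment> \<open>The two admissible values of M enter only through N <= M < n.\<close>
  have N: "2 * N = Suc n" "N \<le> M" "M < n" using assms by (auto simp: N_def elim!: oddE)
  note c = coprime_linear_cyclo_q[of n, unfolded coprime_commute[of _ "cyclo_q n"]]
  have "cong_rat (\<Sum>k=0..M. lhs_term vq va vb vc vd k)
     (qint vq (int n) * Theta vq va vb n * (\<Sum>k=0..N. rhs_term vq va vb vc vd k))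
     (cyclo_q n * (1 - Xa * Xq ^ n) * (Xa - Xq ^ n) * (Xb - Xq ^ n))"
    using coprime_linear_moduli[of n] c assms
    by (intro cong_rat_mult_modulus congruence_cyclo_q congruence_linear N) (auto simp: coprime_commute)
  thus ?thesis unfolding lhs_term_def rhs_term_def N_def .
qed

end
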